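(* Let $\phi^{n},\rho^{n}\in\mathcal{C}_{per}$ be given, with $\|\rho^{n}\|_{\infty}\le M$ for some $M\ge 0$, and $0<\overline{\rho^{n}}<1$. Then there exists a unique solution $(\phi^{n+1},\rho^{n+1})\in\mathcal{C}_{per}\times\mathcal{C}_{per}$ of the numerical scheme $$\frac{\phi^{n+1}-\phi^{n}}{\Delta t}=\mathcal{M}\Delta_h\mu_\phi^{n+1},\qquad \frac{\rho^{n+1}-\rho^{n}}{\Delta t}=\mathcal{M}\Delta_h\mu_\rho^{n+1},$$ with $$\mu_{\phi}^{n+1}=\frac{1}{\varepsilon}\Big(\phi^{n+1}-\frac12\Big)^{3}-\Big(\varepsilon+\alpha+\frac{\alpha}{\delta}\Big)\Delta_h\phi^{n+1}+\eta^{2}\Delta_h^{2}\phi^{n+1}+\alpha\nabla_h\cdot\Big(\mathcal{A}\Big(\frac{\rho^{n+1}}{\mathcal{A}|\nabla_h^\delta\phi^{n+1}|}\Big)\nabla_h\phi^{n+1}\Big)-\frac{1}{4\varepsilon}\Big(\phi^{n}-\frac12\Big)+\frac{\alpha}{\delta}\Delta_h\phi^{n},$$ $$\mu_{\rho}^{n+1}=-\xi\Delta_h\rho^{n+1}+\beta\big(\ln\rho^{n+1}-\ln(1-\rho^{n+1})\big)+\sqrt2\,\alpha\rho^{n+1}-\alpha\,\mathcal{A}|\nabla_h^\delta\phi^{n+1}|-\alpha(\sqrt2-1)\rho^{n},$$ with $0<\rho^{n+1}<1$ at a point-wise level (i.e. $0<\rho^{n+1}_{i,j}<1$ for all $i,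j$).
   Context: Parameters: $\alpha,\beta,\varepsilon,\eta,\xi,\delta,\mathcal{M}>0$ and time step $\Delta t>0$ are fixed constants. Grid: $\Omega=(0,L)^2$, $N\in\mathbb{N}$, $h=L/N$. $\mathcal{C}_{per}$ is the space of real (cell-centered) grid functions $\nu=(\nu_{i,j})_{i,j\in\mathbb{Z}}$ that are $N$-periodic in each index ($\nu_{i,j}$ is the value at the point $(p_i,p_j)$, $p_i=(i-\tfrac12)h$). $\overline{\nu}=\frac{h^2}{|\Omega|}\sum_{i,j=1}^N\nu_{i,j}$ and $\|\nu\|_\infty=\max_{1\le i,j\le N}|\nu_{i,j}|$. Differences: $(D_x\nu)_{i+\frac12,j}=\frac{1}{h}(\nu_{i+1,j}-\nu_{i,j})$, $(D_y\nu)_{i,j+\frac12}=\frac1h(\nu_{i,j+1}-\nu_{i,j})$; $\nabla_h\nu=(D_x\nu,D_y\nu)$ (edge-centered). For an edge-centered vector field $\vec f=(f^x,f^y)$, $(\nabla_h\cdot\vec f)_{i,j}=\frac1h(f^x_{i+\frac12,j}-f^x_{i-\frac12,j})+\frac1h(f^y_{i,j+\frac12}-f^y_{i,j-\frac12})$. $\Delta_h\nu=\nabla_h\cdot(\nabla_h\nu)$ is the standard periodic five-point Laplacian. The cell-centered quantity $\mathcal{A}|\nabla_h^\delta\phi|$ is defined by $$\big(\mathcal{A}|\nabla_h^\delta\phi|_{i,j}\big)^2=\tfrac12\big((D_x\phi)_{i+\frac12,j}^2+(D_x\phi)_{i-\frac12,j}^2+(D_y\phi)_{i,j+\frac12}^2+(D_y\phi)_{i,j-\frac12}^2\big)+\delta^2,\qquad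 \mathcal{A}|\nabla_h^\delta\phi|_{i,j}>0.$$ For a cell-centered $g$, the outer $\mathcal{A}(g)$ in $\nabla_h\cdot(\mathcal{A}(g)\nabla_h\phi)$ is the arithmetic average onto edges: $\mathcal{A}(g)_{i+\frac12,j}=\frac12(g_{i,j}+g_{i+1,j})$, $\mathcal{A}(g)_{i,j+\frac12}=\frac12(g_{i,j}+g_{i,j+1})$. All nonlinear operations on grid functions are point-wise. *)

theory Defs
  imports "HOL-Analysis.Analysis"
begin

text \<open>
  A cell-centered grid function has its value at the point \<open>(p_i, p_j)\<close>, \<open>p_i = (i - 1/2) h\<close>,
  stored at index \<open>(i, j)\<close>.  An edge-centered vector field is a pair \<open>(fx, fy)\<close> in which the
  half-integer indices are rounded down: \<open>fx i j\<close> is the value at \<open>(i + 1/2, j)\<close> and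
  \<open>fy i j\<close> is the value at \<open>(i, j + 1/2)\<close>.
\<close>

type_synonym grid_fun = "int \<Rightarrow> int \<Rightarrow> real"
type_synonym edge_field = "grid_fun \<times> grid_fun"

definition Cper :: "nat \<Rightarrow> grid_fun set" where
  "Cper N = {\<nu>. \<forall>i j. \<nu> (i + int N) j = \<nu> i j \<and> \<nu> i (j + int N) = \<nu> i j}"

text \<open>The domain is \<open>(0, L)\<^sup>2\<close>, so \<open>h = L / N\<close> and the area is \<open>L\<^sup>2\<close>.\<close>

definition grid_mean :: "real \<Rightarrow> nat \<Rightarrow> grid_fun \<Rightarrow> real" where
  "grid_mean L N \<nu> = (L / real N)\<^sup>2 / L\<^sup>2 * (\<Sum>i\<in>{1..int N}. \<Sum>j\<in>{1..int N}. \<nu> i j)"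

definition grid_norm_inf :: "nat \<Rightarrow> grid_fun \<Rightarrow> real" where
  "grid_norm_inf N \<nu> = Max ((\<lambda>(i, j). \<bar>\<nu> i j\<bar>) ` ({1..int N} \<times> {1..int N}))"

definition Dx :: "real \<Rightarrow> grid_fun \<Rightarrow> grid_fun" where
  "Dx h \<nu> = (\<lambda>i j. (\<nu> (i + 1) j - \<nu> i j) / h)"

definition Dy :: "real \<Rightarrow> grid_fun \<Rightarrow> grid_fun" where
  "Dy h \<nu> = (\<lambda>i j. (\<nu> i (j + 1) - \<nu> i j) / h)"

definition grad_h :: "real \<Rightarrow> grid_fun \<Rightarrow> edge_field" where
  "grad_h h \<nu> = (Dx h \<nu>, Dy h \<nu>)"

definition div_h :: "real \<Rightarrow> edge_field \<Rightarrow> grid_fun" where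
  "div_h h f = (\<lambda>i j. (fst f i j - fst f (i - 1) j) / h + (snd f i j - snd f i (j - 1)) / h)"

definition laplace_h :: "real \<Rightarrow> grid_fun \<Rightarrow> grid_fun" where
  "laplace_h h \<nu> = div_h h (grad_h h \<nu>)"

definition avg_grad_norm :: "real \<Rightarrow> real \<Rightarrow> grid_fun \<Rightarrow> grid_fun" where
  "avg_grad_norm h \<delta> \<phi> = (\<lambda>i j. sqrt
     (1 / 2 * ((Dx h \<phi> i j)\<^sup>2 + (Dx h \<phi> (i - 1) j)\<^sup>2 + (Dy h \<phi> i j)\<^sup>2 + (Dy h \<phi> i (j - 1))\<^sup>2) + \<delta>\<^sup>2))"

definition edge_avg :: "grid_fun \<Rightarrow> edge_field" where
  "edge_avg g = ((\<lambda>i j. (g i j + g (i + 1) j) / 2), (\<lambda>i j. (g i j + g i (j + 1)) / 2))"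

definition edge_mult :: "edge_field \<Rightarrow> edge_field \<Rightarrow> edge_field" where
  "edge_mult f g = ((\<lambda>i j. fst f i j * fst g i j), (\<lambda>i j. snd f i j * snd g i j))"

text \<open>
  In the chemical potentials \<open>\<phi>n\<close>, \<open>\<rho>n\<close> are the data of the old time step,
  and \<open>\<phi>\<close>, \<open>\<rho>\<close> are the unknowns of the new one.
\<close>

definition mu_phi ::
  "real \<Rightarrow> real \<Rightarrow> real \<Rightarrow> real \<Rightarrow> real \<Rightarrow> grid_fun \<Rightarrow> grid_fun \<Rightarrow> grid_fun \<Rightarrow> grid_fun" where
  "mu_phi h \<alpha> \<epsilon> \<eta> \<delta> \<phi>n \<phi> \<rho> = (\<lambda>i j.
     1 / \<epsilon> * (\<phi> i j - 1 / 2) ^ 3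
     - (\<epsilon> + \<alpha> + \<alpha> / \<delta>) * laplace_h h \<phi> i j
     + \<eta>\<^sup>2 * laplace_h h (laplace_h h \<phi>) i j
     + \<alpha> * div_h h (edge_mult (edge_avg (\<lambda>k l. \<rho> k l / avg_grad_norm h \<delta> \<phi> k l)) (grad_h h \<phi>)) i j
     - 1 / (4 * \<epsilon>) * (\<phi>n i j - 1 / 2)
     + \<alpha> / \<delta> * laplace_h h \<phi>n i j)"

definition mu_rho ::
  "real \<Rightarrow> real \<Rightarrow> real \<Rightarrow> real \<Rightarrow> real \<Rightarrow> grid_fun \<Rightarrow> grid_fun \<Rightarrow> grid_fun \<Rightarrow> grid_fun" where
  "mu_rho h \<alpha> \<beta> \<xi> \<delta> \<rho>n \<phi> \<rho> = (\<lambda>i j.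
     - \<xi> * laplace_h h \<rho> i j
     + \<beta> * (ln (\<rho> i j) - ln (1 - \<rho> i j))
     + sqrt 2 * \<alpha> * \<rho> i j
     - \<alpha> * avg_grad_norm h \<delta> \<phi> i j
     - \<alpha> * (sqrt 2 - 1) * \<rho>n i j)"

end

theory Submission
  imports Defs "HOL-Real_Asymp.Real_Asymp"
begin

text \<open>
  Write the unknowns as \<open>\<phi> = \<phi>n + \<kappa> \<Delta>\<psi>\<close> and \<open>\<rho> = \<rho>n + \<kappa> \<Delta>\<psi>'\<close> with \<open>\<kappa> = Mob * \<Delta>t\<close>.  The scheme is
  then the Euler-Lagrange system of a coercive energy in \<open>(\<psi>, \<psi>')\<close>, so a minimiser under the
  constraint \<open>0 \<le> \<rho> \<le> 1\<close> exists.  The infinite slope of \<open>x ln x + (1 - x) ln (1 - x)\<close> at 0 and 1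
  keeps the minimiser off the constraint, hence it solves the scheme.  Uniqueness: the pair of
  chemical potentials is a strictly monotone function of \<open>(\<phi>, \<rho>)\<close>, while for two solutions the
  potentials' differences paired with the solutions' differences give minus a Dirichlet energy.
\<close>

section \<open>Sums over one period and summation by parts\<close>

text \<open>The obstacle is the coupling energy
  \<open>- \<alpha> * \<rho> * avg_grad_norm h \<delta> \<phi>\<close>, which is concave in the
  gradient and unbounded below. For 0 \<le> \<rho> \<le> 1 the energy of the \<open>\<alpha>\<close>
  Laplacian absorbs it up to a constant, which gives the lower bound that existence asks for.
  Uniqueness asks for monotonicity; there the \<open>\<alpha> / \<delta>\<close> Laplacian and the
  \<open>sqrt 2 * \<alpha> * \<rho>\<close> term pay for the rest. The scheme is an exact gradient
  only because its edge averages match cell-centered products under summation by parts, so both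
  estimates can be made cell by cell. The closed constraint serves compactness, but the first
  variation in \<rho> exists only once contact with 0 and 1 is excluded. That exclusion needs an
  interior state of the same mass to move towards: the constant state, reachable because its mean
  lies in (0, 1) and the discrete Poisson problem is solvable for mean-zero data.\<close>

definition gsum :: "nat \<Rightarrow> grid_fun \<Rightarrow> real" where
  "gsum N u = (\<Sum>i\<in>{1..int N}. \<Sum>j\<in>{1..int N}. u i j)"

text \<open>The cell-centered inner product belonging to \<open>avg_grad_norm\<close>. Each edge is
  shared by two cells with weight 1/2, so summing over a period gives the usual edge-based Dirichlet
  form.\<close>

definition gradprod :: "real \<Rightarrow> grid_fun \<Rightarrow> grid_fun \<Rightarrow> grid_fun" where
  "gradprod h u v = (\<lambda>i j. (Dx h u i j * Dx h v i j + Dx h u (i - 1) j * Dx h v (i - 1) j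
     + Dy h u i j * Dy h v i j + Dy h u i (j - 1) * Dy h v i (j - 1)) / 2)"

lemma CperI:
  "(\<And>i j. u (i + int N) j = u i j) \<Longrightarrow> (\<And>i j. u i (j + int N) = u i j) \<Longrightarrow> u \<in> Cper N"
  by (simp add: Cper_def)

lemma Cper_period:
  assumes "u \<in> Cper N"
  shows "u (i + int N) j = u i j" "u (i + int N + 1) j = u (i + 1) j"
    "u (i + int N - 1) j = u (i - 1) j"
    "u i (j + int N) = u i j" "u i (j + int N + 1) = u i (j + 1)"
    "u i (j + int N - 1) = u i (j - 1)"
proof -
  have *: "\<forall>i j. u (i + int N) j = u i j \<and> u i (j + int N) = u i j"
    using assms by (simp add: Cper_def)
  show "u (i + int N) j = u i j" "u i (j + int N) = u i j"
    using * by auto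
  show "u (i + int N + 1) j = u (i + 1) j" "u (i + int N - 1) j = u (i - 1) j"
    using *[rule_format, of "i + 1" j] *[rule_format, of "i - 1" j] by (simp_all add: algebra_simps)
  show "u i (j + int N + 1) = u i (j + 1)" "u i (j + int N - 1) = u i (j - 1)"
    using *[rule_format, of i "j + 1"] *[rule_format, of i "j - 1"] by (simp_all add: algebra_simps)
qed

text \<open>The same cell (a, b) serves every periodic v at once, so a statement involving several
  grid functions can be moved into one period.\<close>

lemma Cper_rep:
  assumes "N \<ge> 1"
  obtains a b where "a \<in> {1..int N}" "b \<in> {1..int N}" "\<And>v. v \<in> Cper N \<Longrightarrow> v a b = v i j"
proof -
  have per: "f ((i - 1) mod int N + 1) = f i" if f: "\<And>i. f (i + int N) = f i"
    for f :: "int \<Rightarrow> real" and i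
  proof -
    have f': "f (i + int n * int N) = f i" for n i
    proof (induction n arbitrary: i)
      case (Suc n)
      from Suc[of "i + int N"] f[of i] show ?case by (simp add: algebra_simps)
    qed simp
    have f'': "f (i + k * int N) = f i" for k i
      using f'[of i "nat k"] f'[of "i + k * int N" "nat (- k)"] by (cases "k \<ge> 0") simp_all
    have "(i - 1) mod int N + 1 + (i - 1) div int N * int N = i"
      using div_mult_mod_eq[of "i - 1" "int N"] by linarith
    with f''[of "(i - 1) mod int N + 1" "(i - 1) div int N"] show ?thesis by simp
  qed
  show ?thesis
  proof
    show "(i - 1) mod int N + 1 \<in> {1..int N}" "(j - 1) mod int N + 1 \<in> {1..int N}"
      using assms by (simp_all add: int_one_le_iff_zero_less add1_zle_eq)
    fix v assume v: "v \<in> Cper N"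
    show "v ((i - 1) mod int N + 1) ((j - 1) mod int N + 1) = v i j"
      using per[of "\<lambda>i. v i ((j - 1) mod int N + 1)" i] per[of "\<lambda>j. v i j" j] v
      by (simp add: Cper_def)
  qed
qed

lemma gsum_shift_x:
  assumes "u \<in> Cper N"
  shows "gsum N (\<lambda>i j. u (i - 1) j) = gsum N u"
proof -
  have "(\<Sum>i\<in>{1..int N}. f (i - 1)) = (\<Sum>i\<in>{1..int N}. f i)"
    if "f 0 = f (int N)" for f :: "int \<Rightarrow> real"
  proof -
    have "(\<Sum>i\<in>{1..int N}. f (i - 1)) = (\<Sum>i\<in>{0..<int N}. f i)"
      by (rule sum.reindex_bij_witness[of _ "\<lambda>i. i + 1" "\<lambda>i. i - 1"]) auto
    also have "\<dots> = (\<Sum>i\<in>{1..int N}. f i)"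
      by (rule sum.reindex_bij_witness[of _ "\<lambda>i. if i = int N then 0 else i"
            "\<lambda>i. if i = 0 then int N else i"]) (use that in auto)
    finally show ?thesis .
  qed
  from this[of "\<lambda>i. \<Sum>j\<in>{1..int N}. u i j"] show ?thesis
    using Cper_period(1)[OF assms, of 0] by (simp add: gsum_def)
qed

lemma gsum_transpose: "gsum N (\<lambda>i j. u j i) = gsum N u"
  unfolding gsum_def by (rule sum.swap)

lemma gsum_shift_y:
  assumes "u \<in> Cper N"
  shows "gsum N (\<lambda>i j. u i (j - 1)) = gsum N u"
proof -
  have "(\<lambda>i j. u j i) \<in> Cper N"
    using assms by (auto simp: Cper_def)
  from gsum_shift_x[OF this] show ?thesis
    using gsum_transpose[of N u] gsum_transpose[of N "\<lambda>i j. u i (j - 1)"] by simp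
qed

lemma gsum_linear:
  "gsum N (\<lambda>i j. u i j + v i j) = gsum N u + gsum N v"
  "gsum N (\<lambda>i j. u i j - v i j) = gsum N u - gsum N v"
  "gsum N (\<lambda>i j. - u i j) = - gsum N u"
  "gsum N (\<lambda>i j. c * u i j) = c * gsum N u"
  by (simp_all add: gsum_def sum.distrib sum_subtractf sum_negf sum_distrib_left)

lemma gsum_const: "gsum N (\<lambda>i j. c) = (real N)\<^sup>2 * c"
  by (simp add: gsum_def power2_eq_square)

lemma gsum_mono: "(\<And>i j. u i j \<le> v i j) \<Longrightarrow> gsum N u \<le> gsum N v"
  unfolding gsum_def by (intro sum_mono) auto

lemma gsum_nonneg: "(\<And>i j. 0 \<le> u i j) \<Longrightarrow> 0 \<le> gsum N u"
  using gsum_mono[of "\<lambda>i j. 0" u N] by (simp add: gsum_const)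

lemma gsum_abs: "\<bar>gsum N u\<bar> \<le> gsum N (\<lambda>i j. \<bar>u i j\<bar>)"
  unfolding gsum_def by (rule order_trans[OF sum_abs]) (intro sum_mono sum_abs)

lemma gsum_ge_member:
  assumes "\<And>i j. 0 \<le> u i j" "u \<in> Cper N" "N \<ge> 1"
  shows "u i j \<le> gsum N u"
proof -
  obtain a b where ab: "a \<in> {1..int N}" "b \<in> {1..int N}" "u a b = u i j"
    using Cper_rep[OF assms(3)] assms(2) by metis
  have "u a b \<le> (\<Sum>j\<in>{1..int N}. u a j)"
    by (rule member_le_sum) (use ab assms in auto)
  also have "\<dots> \<le> gsum N u"
    unfolding gsum_def by (rule member_le_sum[of a]) (use ab assms in \<open>auto intro: sum_nonneg\<close>)
  finally show ?thesis using ab by simp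
qed

lemma gsum_eq_0D:
  assumes "gsum N u = 0" "\<And>i j. 0 \<le> u i j" "u \<in> Cper N" "N \<ge> 1"
  shows "u i j = 0"
  using gsum_ge_member[OF assms(2-4), of i j] assms(1,2) by (simp add: order_antisym)

section \<open>Periodicity of the discrete operators and summation by parts\<close>

lemma Dx_Cper: "u \<in> Cper N \<Longrightarrow> Dx h u \<in> Cper N"
  and Dy_Cper: "u \<in> Cper N \<Longrightarrow> Dy h u \<in> Cper N"
  by (rule CperI; simp add: Dx_def Dy_def Cper_period)+

lemma gradprod_Cper: "u \<in> Cper N \<Longrightarrow> v \<in> Cper N \<Longrightarrow> gradprod h u v \<in> Cper N"
  by (rule CperI; simp add: gradprod_def Cper_period Dx_Cper Dy_Cper)

lemma avg_grad_norm_Cper: "u \<in> Cper N \<Longrightarrow> avg_grad_norm h \<delta> u \<in> Cper N"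
  by (rule CperI; simp add: avg_grad_norm_def Cper_period Dx_Cper Dy_Cper)

lemma div_h_Cper: "fst f \<in> Cper N \<Longrightarrow> snd f \<in> Cper N \<Longrightarrow> div_h h f \<in> Cper N"
  by (rule CperI; simp add: div_h_def Cper_period)

lemma flux_Cper:
  assumes "g \<in> Cper N" "u \<in> Cper N"
  shows "div_h h (edge_mult (edge_avg g) (grad_h h u)) \<in> Cper N"
  using assms by (intro div_h_Cper CperI;
      simp add: edge_mult_def edge_avg_def grad_h_def Cper_period Dx_Cper Dy_Cper)

lemma laplace_Cper: "u \<in> Cper N \<Longrightarrow> laplace_h h u \<in> Cper N"
  unfolding laplace_h_def by (intro div_h_Cper) (simp_all add: grad_h_def Dx_Cper Dy_Cper)

text \<open>Two kinds of shift are at work. X and Y are ordinary summation by parts. X' and Y' carry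
  the half of the edge average that belongs to the neighbouring value of g over to the neighbour's
  own cell, which turns edge weights into the cell weights of \<open>gradprod\<close>.\<close>

lemma gsum_flux:
  assumes "g \<in> Cper N" "u \<in> Cper N" "v \<in> Cper N"
  shows "gsum N (\<lambda>i j. div_h h (edge_mult (edge_avg g) (grad_h h u)) i j * v i j)
       = - gsum N (\<lambda>i j. g i j * gradprod h u v i j)"
proof -
  note per = Cper_period[OF assms(1)] Cper_period[OF assms(2)] Cper_period[OF assms(3)]
    Dx_Cper[OF assms(2), THEN Cper_period(1)] Dx_Cper[OF assms(2), THEN Cper_period(4)]
    Dx_Cper[OF assms(3), THEN Cper_period(1)] Dx_Cper[OF assms(3), THEN Cper_period(4)]
    Dy_Cper[OF assms(2), THEN Cper_period(1)] Dy_Cper[OF assms(2), THEN Cper_period(4)]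
    Dy_Cper[OF assms(3), THEN Cper_period(1)] Dy_Cper[OF assms(3), THEN Cper_period(4)]
  define a where "a = (\<lambda>i j. (g i j + g (i + 1) j) / 2 * Dx h u i j)"
  define b where "b = (\<lambda>i j. (g i j + g i (j + 1)) / 2 * Dy h u i j)"
  \<comment> \<open>The telescoping pieces: shift invariance of the sum annihilates them.\<close>
  define X where "X = (\<lambda>i j. a i j * v (i + 1) j / h)"
  define X' where "X' = (\<lambda>i j. g (i + 1) j * Dx h u i j * Dx h v i j / 2)"
  define Y where "Y = (\<lambda>i j. b i j * v i (j + 1) / h)"
  define Y' where "Y' = (\<lambda>i j. g i (j + 1) * Dy h u i j * Dy h v i j / 2)"
  have "X \<in> Cper N" "Y \<in> Cper N" "X' \<in> Cper N" "Y' \<in> Cper N"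
    by (rule CperI; simp add: X_def Y_def X'_def Y'_def a_def b_def per)+
  then have "gsum N (\<lambda>i j. X i j - X (i - 1) j) = 0" "gsum N (\<lambda>i j. Y i j - Y i (j - 1)) = 0"
    "gsum N (\<lambda>i j. X' i j - X' (i - 1) j) = 0" "gsum N (\<lambda>i j. Y' i j - Y' i (j - 1)) = 0"
    by (simp_all add: gsum_linear gsum_shift_x gsum_shift_y)
  moreover have "(\<lambda>i j. div_h h (edge_mult (edge_avg g) (grad_h h u)) i j * v i j) =
    (\<lambda>i j. (X i j - X (i - 1) j) + (Y i j - Y i (j - 1)) - (X' i j - X' (i - 1) j)
       - (Y' i j - Y' i (j - 1)) + - (g i j * gradprod h u v i j))"
    by (intro ext, simp add: X_def Y_def X'_def Y'_def a_def b_def div_h_def edge_mult_def edge_avg_def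
        grad_h_def gradprod_def Dx_def Dy_def)
       (simp add: diff_divide_distrib add_divide_distrib algebra_simps)
  ultimately show ?thesis
    by (simp only: gsum_linear)
qed

section \<open>Pointwise algebra of the discrete gradient product\<close>

lemma gradprod_sym: "gradprod h u v = gradprod h v u"
  by (simp add: gradprod_def mult.commute)

lemma gradprod_self_nonneg: "0 \<le> gradprod h u u i j"
  by (simp add: gradprod_def)

lemma gradprod_linear:
  "gradprod h (\<lambda>i j. u i j + t * v i j) w i j = gradprod h u w i j + t * gradprod h v w i j"
  "gradprod h (\<lambda>i j. u i j - v i j) w i j = gradprod h u w i j - gradprod h v w i j"
  by (simp_all add: gradprod_def Dx_def Dy_def diff_divide_distrib add_divide_distrib algebra_simps)

lemma gradprod_linear_right:
  "gradprod h w (\<lambda>i j. u i j + t * v i j) i j = gradprod h w u i j + t * gradprod h w v i j"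
  "gradprod h w (\<lambda>i j. u i j - v i j) i j = gradprod h w u i j - gradprod h w v i j"
  by (simp_all only: gradprod_sym[of h w] gradprod_linear)

text \<open>Lagrange's identity in dimension four: the defect in Cauchy-Schwarz is the sum of the
  six squared 2 by 2 minors.\<close>

lemma gradprod_Cauchy_Schwarz:
  "(gradprod h u v i j)\<^sup>2 \<le> gradprod h u u i j * gradprod h v v i j"
proof -
  have "(a * p + b * q + c * r + d * s)\<^sup>2 \<le> (a * a + b * b + c * c + d * d) * (p * p + q * q + r * r + s * s)"
    for a b c d p q r s :: real
  proof -
    have "0 \<le> (a * q - b * p)\<^sup>2 + (a * r - c * p)\<^sup>2 + (a * s - d * p)\<^sup>2 + (b * r - c * q)\<^sup>2 + (b * s - d * q)\<^sup>2
       + (c * s - d * r)\<^sup>2"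
      by (intro add_nonneg_nonneg zero_le_power2)
    also have "\<dots> = (a * a + b * b + c * c + d * d) * (p * p + q * q + r * r + s * s) - (a * p + b * q + c * r + d * s)\<^sup>2"
      by (simp add: power2_eq_square algebra_simps)
    finally show ?thesis by simp
  qed
  then show ?thesis
    unfolding gradprod_def by (simp add: power_divide)
qed

lemma avg_grad_norm_gradprod: "avg_grad_norm h \<delta> u i j = sqrt (gradprod h u u i j + \<delta>\<^sup>2)"
  by (simp add: avg_grad_norm_def gradprod_def power2_eq_square)

lemma avg_grad_norm_ge:
  assumes "\<delta> > 0"
  shows "\<delta> \<le> avg_grad_norm h \<delta> u i j"
  unfolding avg_grad_norm_gradprod
  by (rule real_le_rsqrt) (simp add: gradprod_self_nonneg)

lemma avg_grad_norm_square: "(avg_grad_norm h \<delta> u i j)\<^sup>2 = gradprod h u u i j + \<delta>\<^sup>2"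
  by (simp add: avg_grad_norm_gradprod gradprod_self_nonneg)

text \<open>Cauchy-Schwarz for gradients extended by a further component \<delta>. The cross terms
  in \<delta> are handled by the nonnegativity of the product for u - v.\<close>

lemma gradprod_le_avg_grad_norm:
  assumes "\<delta> > 0"
  shows "gradprod h u v i j + \<delta>\<^sup>2 \<le> avg_grad_norm h \<delta> u i j * avg_grad_norm h \<delta> v i j"
proof -
  let ?x = "gradprod h u u i j" and ?y = "gradprod h v v i j" and ?z = "gradprod h u v i j"
  have "0 \<le> ?x + ?y - 2 * ?z"
    using gradprod_self_nonneg[of h "\<lambda>i j. u i j - v i j" i j]
    by (simp add: gradprod_linear gradprod_linear_right gradprod_sym[of h v u])
  then have "0 \<le> (?x + ?y - 2 * ?z) * \<delta>\<^sup>2" by simp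
  then have "(?z + \<delta>\<^sup>2)\<^sup>2 \<le> (?x + \<delta>\<^sup>2) * (?y + \<delta>\<^sup>2)"
    using gradprod_Cauchy_Schwarz[of h u v i j] by (simp add: power2_eq_square algebra_simps)
  then have "?z + \<delta>\<^sup>2 \<le> sqrt ((?x + \<delta>\<^sup>2) * (?y + \<delta>\<^sup>2))"
    by (rule real_le_rsqrt)
  then show ?thesis
    by (simp add: avg_grad_norm_gradprod real_sqrt_mult)
qed

section \<open>The discrete Laplacian\<close>

lemma laplace_flux:
  "laplace_h h u = div_h h (edge_mult (edge_avg (\<lambda>i j. 1)) (grad_h h u))"
  by (simp add: laplace_h_def edge_mult_def edge_avg_def)

lemma gsum_laplace:
  assumes "u \<in> Cper N" "v \<in> Cper N"
  shows "gsum N (\<lambda>i j. laplace_h h u i j * v i j) = - gsum N (gradprod h u v)"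
  using gsum_flux[of "\<lambda>i j. 1" N u v h] assms by (simp add: laplace_flux Cper_def)

lemma gsum_laplace_sym:
  assumes "u \<in> Cper N" "v \<in> Cper N"
  shows "gsum N (\<lambda>i j. laplace_h h u i j * v i j) = gsum N (\<lambda>i j. u i j * laplace_h h v i j)"
  using gsum_laplace[OF assms, of h] gsum_laplace[OF assms(2,1), of h] gradprod_sym[of h u v]
  by (simp add: mult.commute)

lemma laplace_linear:
  "laplace_h h (\<lambda>i j. u i j + t * v i j) i j = laplace_h h u i j + t * laplace_h h v i j"
  "laplace_h h (\<lambda>i j. u i j - v i j) i j = laplace_h h u i j - laplace_h h v i j"
  by (simp_all add: laplace_h_def div_h_def grad_h_def Dx_def Dy_def diff_divide_distrib
      add_divide_distrib algebra_simps)

section \<open>Monotonicity and uniqueness\<close>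

text \<open>
  The stabilising terms of the scheme absorb the non-monotone coupling \<open>- \<rho> |\<nabla>\<phi>|\<close>.  Here \<open>Gk\<close> is the regularised
  gradient norm of \<open>\<phi>k\<close>, \<open>w\<close> the inner product of the two regularised gradients and
  \<open>D = |\<nabla>\<phi>1 - \<nabla>\<phi>2|\<^sup>2\<close>.
\<close>

lemma coupling_monotone:
  fixes r1 r2 G1 G2 D w \<delta> :: real
  assumes "0 < \<delta>" "\<delta> \<le> G1" "\<delta> \<le> G2" "0 \<le> r1" "r1 \<le> 1" "0 \<le> r2" "r2 \<le> 1"
    and D: "D = G1\<^sup>2 + G2\<^sup>2 - 2 * w" and w: "w \<le> G1 * G2"
  shows "r1 / G1 * (G1\<^sup>2 - w) - r2 / G2 * (w - G2\<^sup>2) + (G1 - G2) * (r1 - r2)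
       \<le> D + D / \<delta> + sqrt 2 * (r1 - r2)\<^sup>2"
proof -
  define s where "s = G1 - G2"
  define r where "r = r1 - r2"
  have G: "G1 > 0" "G2 > 0" using assms by auto
  have sD: "s\<^sup>2 \<le> D"
    using w D by (simp add: s_def power2_eq_square algebra_simps)
  then have "D \<ge> 0" by (meson order_trans zero_le_power2)
  \<comment> \<open>Polarisation eliminates w. In what follows the s^2 term has a favourable sign,
    and the D term with 0 \<le> r1, r2 \<le> 1 and G1, G2 \<ge> \<delta> yields exactly D /
    \<delta>.\<close>
  have w': "w = (G1\<^sup>2 + G2\<^sup>2 - D) / 2" using D by simp
  have "r1 / G1 * (G1\<^sup>2 - w) - r2 / G2 * (w - G2\<^sup>2) + (G1 - G2) * (r1 - r2)
      = 2 * r * s - s\<^sup>2 * (r1 / (2 * G1) + r2 / (2 * G2)) + D / 2 * (r1 / G1 + r2 / G2)"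
    using G unfolding w' s_def r_def by (simp add: field_simps power2_eq_square)
  also have "\<dots> \<le> 2 * r * s + D / \<delta>"
  proof -
    have "r1 / G1 \<le> 1 / \<delta>" "r2 / G2 \<le> 1 / \<delta>"
      using assms by (simp_all add: frac_le)
    then have "D / 2 * (r1 / G1 + r2 / G2) \<le> D / 2 * (1 / \<delta> + 1 / \<delta>)"
      using \<open>D \<ge> 0\<close> by (intro mult_left_mono) auto
    moreover have "0 \<le> s\<^sup>2 * (r1 / (2 * G1) + r2 / (2 * G2))"
      using assms G by simp
    moreover have "D / 2 * (1 / \<delta> + 1 / \<delta>) = D / \<delta>" by simp
    ultimately show ?thesis by linarith
  qed
  \<comment> \<open>Young's inequality splits the true coupling: s^2 is at most D, and r^2 is paid
    for by the \<open>sqrt 2\<close> term.\<close>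
  also have "2 * r * s \<le> s\<^sup>2 + r\<^sup>2"
    using zero_le_power2[of "s - r"] by (simp add: power2_eq_square algebra_simps)
  also have "r\<^sup>2 \<le> sqrt 2 * r\<^sup>2"
    using mult_right_mono[of 1 "sqrt 2" "r\<^sup>2"] by simp
  finally show ?thesis using sD unfolding r_def by simp
qed

section \<open>Monotonicity of the logit and cubic nonlinearities\<close>

definition logit :: "real \<Rightarrow> real" where
  "logit x = ln x - ln (1 - x)"

lemma logit_strict_mono: "0 < x \<Longrightarrow> x < y \<Longrightarrow> y < 1 \<Longrightarrow> logit x < logit y"
  unfolding logit_def by (intro diff_strict_mono) simp_all

lemma logit_mono: "0 < x \<Longrightarrow> x \<le> y \<Longrightarrow> y < 1 \<Longrightarrow> logit x \<le> logit y"
  using logit_strict_mono by (cases "x = y") (auto intro: less_imp_le)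

lemma logit_diff_nonneg:
  assumes "0 < x" "x < 1" "0 < y" "y < 1"
  shows "0 \<le> (logit x - logit y) * (x - y)"
  using logit_mono[of x y] logit_mono[of y x] assms
  by (cases "x \<le> y") (auto simp: mult_nonneg_nonneg mult_nonpos_nonpos)

lemma logit_diff_pos:
  assumes "0 < x" "x < 1" "0 < y" "y < 1" "x \<noteq> y"
  shows "0 < (logit x - logit y) * (x - y)"
  using logit_strict_mono[of x y] logit_strict_mono[of y x] assms
  by (cases "x < y") (auto simp: mult_neg_neg)

lemma cube_diff_nonneg: "0 \<le> (x ^ 3 - y ^ 3) * (x - y)" for x y :: real
  using power_mono_odd[of 3 x y] power_mono_odd[of 3 y x]
  by (cases "x \<le> y") (auto simp: mult_nonneg_nonneg mult_nonpos_nonpos)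

section \<open>Weak forms, monotonicity of the chemical potentials, uniqueness\<close>

locale phase_scheme =
  fixes \<alpha> \<beta> \<epsilon> \<eta> \<xi> \<delta> \<kappa> h :: real and N :: nat and \<phi>n \<rho>n :: grid_fun
  assumes pos: "\<alpha> > 0" "\<beta> > 0" "\<epsilon> > 0" "\<eta> > 0" "\<xi> > 0" "\<delta> > 0" "\<kappa> > 0" "h > 0" "N \<ge> 1"
    and data_Cper: "\<phi>n \<in> Cper N" "\<rho>n \<in> Cper N"
begin

abbreviation "mu1 \<equiv> mu_phi h \<alpha> \<epsilon> \<eta> \<delta> \<phi>n"
abbreviation "mu2 \<equiv> mu_rho h \<alpha> \<beta> \<xi> \<delta> \<rho>n"

abbreviation "lap \<equiv> laplace_h h"
abbreviation "grp \<equiv> gradprod h"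
abbreviation "agn \<equiv> avg_grad_norm h \<delta>"

definition "phi_data = (\<lambda>i j. \<alpha> / \<delta> * lap \<phi>n i j - 1 / (4 * \<epsilon>) * (\<phi>n i j - 1 / 2))"

lemma quotient_Cper:
  "\<rho> \<in> Cper N \<Longrightarrow> \<phi> \<in> Cper N \<Longrightarrow> (\<lambda>k l. \<rho> k l / agn \<phi> k l) \<in> Cper N"
  by (intro CperI) (simp_all add: Cper_period avg_grad_norm_Cper)

lemma mu1_Cper:
  assumes "\<phi> \<in> Cper N" "\<rho> \<in> Cper N"
  shows "mu1 \<phi> \<rho> \<in> Cper N"
  by (rule CperI; simp add: mu_phi_def Cper_period assms laplace_Cper data_Cper
      flux_Cper[OF quotient_Cper[OF assms(2,1)] assms(1)])

lemma mu2_Cper: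
  assumes "\<phi> \<in> Cper N" "\<rho> \<in> Cper N"
  shows "mu2 \<phi> \<rho> \<in> Cper N"
  by (rule CperI; simp add: mu_rho_def Cper_period assms laplace_Cper data_Cper avg_grad_norm_Cper)

text \<open>The summand on the right is written so as to be, term by term, the directional
  derivative of the energy density; it serves both monotonicity and the Euler-Lagrange
  equation.\<close>

lemma mu1_weak:
  assumes [simp]: "\<phi> \<in> Cper N" "\<rho> \<in> Cper N" "v \<in> Cper N"
  shows "gsum N (\<lambda>i j. mu1 \<phi> \<rho> i j * v i j) = gsum N (\<lambda>i j.
     1 / \<epsilon> * (\<phi> i j - 1 / 2) ^ 3 * v i j + (\<epsilon> + \<alpha> + \<alpha> / \<delta>) * grp \<phi> v i j
     + \<eta>\<^sup>2 * (lap \<phi> i j * lap v i j) - \<alpha> * (\<rho> i j / agn \<phi> i j * grp \<phi> v i j)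
     + phi_data i j * v i j)"
proof -
  let ?f = "div_h h (edge_mult (edge_avg (\<lambda>k l. \<rho> k l / agn \<phi> k l)) (grad_h h \<phi>))"
  have "(\<lambda>i j. mu1 \<phi> \<rho> i j * v i j) = (\<lambda>i j.
     1 / \<epsilon> * (\<phi> i j - 1 / 2) ^ 3 * v i j - (\<epsilon> + \<alpha> + \<alpha> / \<delta>) * (lap \<phi> i j * v i j)
     + \<eta>\<^sup>2 * (lap (lap \<phi>) i j * v i j) + \<alpha> * (?f i j * v i j) + phi_data i j * v i j)"
    unfolding mu_phi_def phi_data_def by (intro ext) algebra
  then show ?thesis
    by (simp only: gsum_linear gsum_laplace[OF assms(1,3)] gsum_flux[OF quotient_Cper] assms
        gsum_laplace_sym[OF laplace_Cper[OF assms(1)] assms(3)])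
qed

lemma mu2_weak:
  assumes [simp]: "\<phi> \<in> Cper N" "\<rho> \<in> Cper N" "v \<in> Cper N"
  shows "gsum N (\<lambda>i j. mu2 \<phi> \<rho> i j * v i j) = gsum N (\<lambda>i j.
     \<xi> * grp \<rho> v i j + \<beta> * logit (\<rho> i j) * v i j + sqrt 2 * \<alpha> * \<rho> i j * v i j
     - \<alpha> * agn \<phi> i j * v i j - \<alpha> * (sqrt 2 - 1) * \<rho>n i j * v i j)"
proof -
  have "(\<lambda>i j. mu2 \<phi> \<rho> i j * v i j) = (\<lambda>i j.
     (- \<xi>) * (lap \<rho> i j * v i j) + \<beta> * logit (\<rho> i j) * v i j + sqrt 2 * \<alpha> * \<rho> i j * v i j
     - \<alpha> * agn \<phi> i j * v i j - \<alpha> * (sqrt 2 - 1) * \<rho>n i j * v i j)"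
    unfolding mu_rho_def logit_def by (intro ext) (simp add: algebra_simps)
  then show ?thesis
    by (simp only: gsum_linear gsum_laplace assms)
qed

text \<open>After summation by parts the claim holds in each cell. \<open>coupling_monotone\<close>
  absorbs the coupling; the remaining gradient and Laplacian squares are nonnegative and are
  dropped. The old-time terms cancel in the differences.\<close>

lemma mu_monotone:
  assumes [simp]: "\<phi>1 \<in> Cper N" "\<rho>1 \<in> Cper N" "\<phi>2 \<in> Cper N" "\<rho>2 \<in> Cper N"
    and r1: "\<And>i j. 0 < \<rho>1 i j" "\<And>i j. \<rho>1 i j < 1"
    and r2: "\<And>i j. 0 < \<rho>2 i j" "\<And>i j. \<rho>2 i j < 1"
  shows "gsum N (\<lambda>i j. 1 / \<epsilon> * (((\<phi>1 i j - 1 / 2) ^ 3 - (\<phi>2 i j - 1 / 2) ^ 3) * (\<phi>1 i j - \<phi>2 i j))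
       + \<beta> * ((logit (\<rho>1 i j) - logit (\<rho>2 i j)) * (\<rho>1 i j - \<rho>2 i j)))
    \<le> gsum N (\<lambda>i j. (mu1 \<phi>1 \<rho>1 i j - mu1 \<phi>2 \<rho>2 i j) * (\<phi>1 i j - \<phi>2 i j))
     + gsum N (\<lambda>i j. (mu2 \<phi>1 \<rho>1 i j - mu2 \<phi>2 \<rho>2 i j) * (\<rho>1 i j - \<rho>2 i j))"
    (is "gsum N ?E \<le> ?R")
proof -
  let ?v = "\<lambda>i j. \<phi>1 i j - \<phi>2 i j" and ?r = "\<lambda>i j. \<rho>1 i j - \<rho>2 i j"
  have [simp]: "?v \<in> Cper N" "?r \<in> Cper N"
    by (rule CperI; simp add: Cper_period)+
  define W1 where "W1 = (\<lambda>\<phi> \<rho> i j. 1 / \<epsilon> * (\<phi> i j - 1 / 2) ^ 3 * ?v i j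
     + (\<epsilon> + \<alpha> + \<alpha> / \<delta>) * grp \<phi> ?v i j
     + \<eta>\<^sup>2 * (lap \<phi> i j * lap ?v i j) - \<alpha> * (\<rho> i j / agn \<phi> i j * grp \<phi> ?v i j)
     + phi_data i j * ?v i j)"
  define W2 where "W2 = (\<lambda>\<phi> \<rho> i j. \<xi> * grp \<rho> ?r i j + \<beta> * logit (\<rho> i j) * ?r i j
     + sqrt 2 * \<alpha> * \<rho> i j * ?r i j - \<alpha> * agn \<phi> i j * ?r i j
     - \<alpha> * (sqrt 2 - 1) * \<rho>n i j * ?r i j)"
  have "?R = gsum N (\<lambda>i j. (W1 \<phi>1 \<rho>1 i j - W1 \<phi>2 \<rho>2 i j) + (W2 \<phi>1 \<rho>1 i j - W2 \<phi>2 \<rho>2 i j))"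
    using mu1_weak[of \<phi>1 \<rho>1 ?v] mu1_weak[of \<phi>2 \<rho>2 ?v] mu2_weak[of \<phi>1 \<rho>1 ?r] mu2_weak[of \<phi>2 \<rho>2 ?r]
    unfolding W1_def W2_def by (simp add: left_diff_distrib gsum_linear)
  moreover have "?E i j \<le> (W1 \<phi>1 \<rho>1 i j - W1 \<phi>2 \<rho>2 i j) + (W2 \<phi>1 \<rho>1 i j - W2 \<phi>2 \<rho>2 i j)" for i j
  proof -
    define G1 where "G1 = agn \<phi>1 i j"
    define G2 where "G2 = agn \<phi>2 i j"
    define w where "w = grp \<phi>1 \<phi>2 i j + \<delta>\<^sup>2"
    define D where "D = grp ?v ?v i j"
    have x: "grp \<phi>1 ?v i j = G1\<^sup>2 - w" "grp \<phi>2 ?v i j = w - G2\<^sup>2"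
      unfolding G1_def G2_def w_def avg_grad_norm_square
      by (simp_all add: gradprod_linear_right gradprod_sym[of h \<phi>2 \<phi>1])
    have D: "D = G1\<^sup>2 + G2\<^sup>2 - 2 * w"
      unfolding D_def using gradprod_linear(2)[of h \<phi>1 \<phi>2 ?v i j] x by simp
    have "\<rho>1 i j / G1 * (G1\<^sup>2 - w) - \<rho>2 i j / G2 * (w - G2\<^sup>2) + (G1 - G2) * ?r i j
       \<le> D + D / \<delta> + sqrt 2 * (?r i j)\<^sup>2"
      by (rule coupling_monotone[OF pos(6) _ _ _ _ _ _ D])
        (use r1[of i j] r2[of i j] gradprod_le_avg_grad_norm[OF pos(6)] avg_grad_norm_ge[OF pos(6)]
          in \<open>auto simp: G1_def G2_def w_def\<close>)
    then have "0 \<le> \<alpha> * (D + D / \<delta> + sqrt 2 * (?r i j)\<^sup>2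
        - (\<rho>1 i j / G1 * (G1\<^sup>2 - w) - \<rho>2 i j / G2 * (w - G2\<^sup>2) + (G1 - G2) * ?r i j))"
      using pos by simp
    moreover have "0 \<le> \<epsilon> * D + \<eta>\<^sup>2 * (lap ?v i j)\<^sup>2 + \<xi> * grp ?r ?r i j"
      using pos unfolding D_def by (intro add_nonneg_nonneg mult_nonneg_nonneg)
        (auto simp: gradprod_self_nonneg)
    moreover have "W1 \<phi>1 \<rho>1 i j - W1 \<phi>2 \<rho>2 i j =
      1 / \<epsilon> * (((\<phi>1 i j - 1 / 2) ^ 3 - (\<phi>2 i j - 1 / 2) ^ 3) * ?v i j)
      + (\<epsilon> + \<alpha> + \<alpha> / \<delta>) * D + \<eta>\<^sup>2 * (lap ?v i j)\<^sup>2
      - \<alpha> * (\<rho>1 i j / G1 * (G1\<^sup>2 - w) - \<rho>2 i j / G2 * (w - G2\<^sup>2))"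
      unfolding W1_def x D G1_def[symmetric] G2_def[symmetric] laplace_linear
      by algebra
    moreover have "W2 \<phi>1 \<rho>1 i j - W2 \<phi>2 \<rho>2 i j =
      \<xi> * grp ?r ?r i j + \<beta> * ((logit (\<rho>1 i j) - logit (\<rho>2 i j)) * ?r i j)
      + sqrt 2 * \<alpha> * (?r i j)\<^sup>2 - \<alpha> * (G1 - G2) * ?r i j"
      unfolding W2_def G1_def[symmetric] G2_def[symmetric] gradprod_linear(2)[of h \<rho>1 \<rho>2]
      by algebra
    ultimately show ?thesis
      by (simp add: algebra_simps)
  qed
  ultimately show ?thesis
    by (simp add: gsum_mono)
qed

definition solves where
  "solves \<phi> \<rho> \<longleftrightarrow> \<phi> \<in> Cper N \<and> \<rho> \<in> Cper N \<and> (\<forall>i j. 0 < \<rho> i j \<and> \<rho> i j < 1)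
     \<and> (\<forall>i j. \<phi> i j - \<phi>n i j = \<kappa> * lap (mu1 \<phi> \<rho>) i j)
     \<and> (\<forall>i j. \<rho> i j - \<rho>n i j = \<kappa> * lap (mu2 \<phi> \<rho>) i j)"

text \<open>Monotonicity and dissipation squeeze a sum of nonnegative terms to zero. The cube and
  the logit are injective, so equality follows in every cell and not merely up to a
  constant.\<close>

lemma solves_unique:
  assumes "solves \<phi>1 \<rho>1" "solves \<phi>2 \<rho>2"
  shows "\<phi>1 = \<phi>2" "\<rho>1 = \<rho>2"
proof -
  have per: "\<phi>1 \<in> Cper N" "\<rho>1 \<in> Cper N" "\<phi>2 \<in> Cper N" "\<rho>2 \<in> Cper N"
    and r1: "\<And>i j. 0 < \<rho>1 i j" "\<And>i j. \<rho>1 i j < 1"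
    and r2: "\<And>i j. 0 < \<rho>2 i j" "\<And>i j. \<rho>2 i j < 1"
    using assms by (auto simp: solves_def)
  have dissip: "gsum N (\<lambda>i j. (m i j - m' i j) * (u i j - u' i j)) \<le> 0"
    if "m \<in> Cper N" "m' \<in> Cper N" "\<And>i j. u i j - w i j = \<kappa> * lap m i j"
      "\<And>i j. u' i j - w i j = \<kappa> * lap m' i j" for m m' u u' w
  proof -
    let ?m = "\<lambda>i j. m i j - m' i j"
    have m: "?m \<in> Cper N" by (rule CperI; simp add: Cper_period that(1,2))
    have "u i j - u' i j = \<kappa> * lap ?m i j" for i j
      using that(3,4)[of i j] by (simp add: laplace_linear algebra_simps)
    then have "gsum N (\<lambda>i j. ?m i j * (u i j - u' i j))
        = \<kappa> * gsum N (\<lambda>i j. lap ?m i j * ?m i j)"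
      by (simp only: gsum_linear[symmetric]) (simp add: mult_ac)
    also have "\<dots> = - (\<kappa> * gsum N (grp ?m ?m))"
      using gsum_laplace[OF m m, of h] by simp
    also have "\<dots> \<le> 0"
      using pos gsum_nonneg[of "grp ?m ?m" N] by (simp add: gradprod_self_nonneg)
    finally show ?thesis .
  qed
  define E where "E = (\<lambda>i j. 1 / \<epsilon> * (((\<phi>1 i j - 1 / 2) ^ 3 - (\<phi>2 i j - 1 / 2) ^ 3) * (\<phi>1 i j - \<phi>2 i j))
       + \<beta> * ((logit (\<rho>1 i j) - logit (\<rho>2 i j)) * (\<rho>1 i j - \<rho>2 i j)))"
  have nonneg: "0 \<le> 1 / \<epsilon> * (((\<phi>1 i j - 1 / 2) ^ 3 - (\<phi>2 i j - 1 / 2) ^ 3) * (\<phi>1 i j - \<phi>2 i j))"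
    "0 \<le> \<beta> * ((logit (\<rho>1 i j) - logit (\<rho>2 i j)) * (\<rho>1 i j - \<rho>2 i j))" for i j
    using cube_diff_nonneg[of "\<phi>1 i j - 1 / 2" "\<phi>2 i j - 1 / 2"] logit_diff_nonneg r1 r2 pos
    by auto
  have "gsum N E \<le> 0"
    using mu_monotone[OF per r1 r2]
      dissip[of "mu1 \<phi>1 \<rho>1" "mu1 \<phi>2 \<rho>2" \<phi>1 \<phi>n \<phi>2] dissip[of "mu2 \<phi>1 \<rho>1" "mu2 \<phi>2 \<rho>2" \<rho>1 \<rho>n \<rho>2]
      assms mu1_Cper mu2_Cper unfolding solves_def E_def by fastforce
  moreover have "0 \<le> E i j" for i j
    unfolding E_def using nonneg by simp
  moreover have "E \<in> Cper N"
    unfolding E_def by (rule CperI; simp add: Cper_period per)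
  ultimately have E0: "E i j = 0" for i j
    by (metis gsum_eq_0D gsum_nonneg order_antisym pos(9))
  have "\<rho>1 i j = \<rho>2 i j" for i j
    using E0[of i j] nonneg[of i j] logit_diff_pos[of "\<rho>1 i j" "\<rho>2 i j"] r1[of i j] r2[of i j] pos
    unfolding E_def by (fastforce simp: add_nonneg_eq_0_iff)
  then show "\<rho>1 = \<rho>2" by blast
  have "\<phi>1 i j = \<phi>2 i j" for i j
  proof -
    have "(\<phi>1 i j - 1 / 2) ^ 3 = (\<phi>2 i j - 1 / 2) ^ 3 \<or> \<phi>1 i j = \<phi>2 i j"
      using E0[of i j] nonneg[of i j] pos unfolding E_def by (auto simp: add_nonneg_eq_0_iff)
    then show ?thesis
      using odd_real_root_power_cancel[of 3 "\<phi>1 i j - 1 / 2"]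
        odd_real_root_power_cancel[of 3 "\<phi>2 i j - 1 / 2"]
      by (metis diff_left_imp_eq add_diff_cancel_right' diff_add_cancel odd_numeral)
  qed
  then show "\<phi>1 = \<phi>2" by blast
qed

end

section \<open>Compactness and the discrete Poisson problem\<close>

text \<open>Tychonoff, once for each index: grid functions carry the product topology, so
  convergence is pointwise.\<close>

lemma compact_bounded_grid_funs: "compact {u :: grid_fun. \<forall>i j. \<bar>u i j\<bar> \<le> R}"
proof -
  have c: "compact (PiE UNIV S)" if "\<And>i. compact (S i)" for S :: "int \<Rightarrow> 'b::topological_space set"
    using that compactin_PiE[of "\<lambda>i. euclidean" "UNIV :: int set" S]
    by (simp add: euclidean_product_topology)
  have "{u :: grid_fun. \<forall>i j. \<bar>u i j\<bar> \<le> R} = PiE UNIV (\<lambda>i. PiE UNIV (\<lambda>j. {-R..R}))"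
    by (auto simp: PiE_def Pi_def abs_le_iff minus_le_iff)
  then show ?thesis by (simp add: c)
qed

lemma attains_min_coercive:
  fixes J :: "'a::topological_space \<Rightarrow> real"
  assumes "closed A" "continuous_on A J" "s0 \<in> A" "compact K"
    and "\<And>s. s \<in> A \<Longrightarrow> J s \<le> J s0 \<Longrightarrow> s \<in> K"
  shows "\<exists>s\<in>A. \<forall>t\<in>A. J s \<le> J t"
proof -
  have s0: "s0 \<in> K \<inter> A" using assms by blast
  have "compact (K \<inter> A)" "continuous_on (K \<inter> A) J"
    using assms by (auto intro: compact_Int_closed continuous_on_subset)
  with s0 obtain s where s: "s \<in> K \<inter> A" "\<forall>t\<in>K \<inter> A. J s \<le> J t"
    using continuous_attains_inf[of "K \<inter> A" J] by blast
  have "J s \<le> J t" if t: "t \<in> A" for t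
  proof (cases "t \<in> K")
    case False
    then have "J s0 < J t" using assms(5)[OF t] by force
    with bspec[OF s(2) s0] show ?thesis by simp
  qed (use s t in blast)
  with s show ?thesis by blast
qed

lemma continuous_on_grid_eval:
  "continuous_on A (\<lambda>u :: grid_fun. u i j)"
  by (rule continuous_on_product_then_coordinatewise, rule continuous_on_product_then_coordinatewise)
    (rule continuous_on_id)

lemma closed_Cper: "closed (Cper N)"
  unfolding Cper_def
  by (intro closed_Collect_all closed_Collect_conj closed_Collect_eq continuous_on_grid_eval)

lemma grid_continuous_intros:
  assumes "\<And>i j. continuous_on A (\<lambda>s. u s i j)"
  shows "continuous_on A (\<lambda>s. Dx h (u s) i j)" "continuous_on A (\<lambda>s. Dy h (u s) i j)"
    "continuous_on A (\<lambda>s. gradprod h (u s) (u s) i j)"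
    "continuous_on A (\<lambda>s. laplace_h h (u s) i j)"
    "continuous_on A (\<lambda>s. avg_grad_norm h \<delta> (u s) i j)"
    "continuous_on A (\<lambda>s. gsum N (u s))"
  unfolding gradprod_def laplace_h_def div_h_def grad_h_def avg_grad_norm_def Dx_def Dy_def
    divide_inverse gsum_def fst_conv snd_conv
  by (intro continuous_intros assms)+

text \<open>A discrete Poincare inequality. Move the cell into one period and walk there from (0,
  0), along the x axis and then up a column: at most 2N steps, each changing u by at most
  \<open>e\<close>. The inner factor 2 undoes the weight 1/2 in \<open>gradprod\<close>.\<close>

lemma grid_bound:
  assumes u: "u \<in> Cper N" "u 0 0 = 0" and "N \<ge> 1" "h > 0"
  shows "\<bar>u i j\<bar> \<le> 2 * real N * h * sqrt (2 * gsum N (gradprod h u u))"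
proof -
  define e where "e = h * sqrt (2 * gsum N (gradprod h u u))"
  have Q: "gradprod h u u i j \<le> gsum N (gradprod h u u)" for i j
    by (rule gsum_ge_member) (use assms in \<open>auto simp: gradprod_self_nonneg gradprod_Cper\<close>)
  have edge: "\<bar>d / h * h\<bar> \<le> e" if "(d / h)\<^sup>2 \<le> 2 * gradprod h u u i j" for d i j
  proof -
    have "\<bar>d / h\<bar> \<le> sqrt (2 * gsum N (gradprod h u u))"
      by (rule real_le_rsqrt) (use that Q[of i j] in \<open>unfold power2_abs, linarith\<close>)
    then show ?thesis
      using \<open>h > 0\<close> unfolding e_def by (simp add: pos_divide_le_eq mult.commute)
  qed
  have "(Dx h u i j)\<^sup>2 \<le> 2 * gradprod h u u i j" "(Dy h u i j)\<^sup>2 \<le> 2 * gradprod h u u i j" for i j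
    by (simp_all add: gradprod_def power2_eq_square)
  note * = this[unfolded Dx_def Dy_def, THEN edge]
  have stepx: "\<bar>u (i + 1) j - u i j\<bar> \<le> e" and stepy: "\<bar>u i (j + 1) - u i j\<bar> \<le> e" for i j
    using *[of i j] \<open>h > 0\<close> by simp_all
  have x: "\<bar>u (int n) 0\<bar> \<le> real n * e" for n
  proof (induction n)
    case (Suc n)
    then show ?case using stepx[of "int n" 0] by (simp add: algebra_simps)
  qed (use u in simp)
  have y: "\<bar>u i (int n) - u i 0\<bar> \<le> real n * e" for i n
  proof (induction n)
    case (Suc n)
    then show ?case using stepy[of i "int n"] by (simp add: algebra_simps)
  qed simp
  have "e \<ge> 0" using stepx[of 0 0] by linarith
  obtain a b where ab: "a \<in> {1..int N}" "b \<in> {1..int N}" "u a b = u i j"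
    using Cper_rep[OF \<open>N \<ge> 1\<close>] u(1) by metis
  have "\<bar>u a b\<bar> \<le> \<bar>u (int (nat a)) 0\<bar> + \<bar>u a (int (nat b)) - u a 0\<bar>"
    using ab by simp
  also have "\<dots> \<le> real (nat a) * e + real (nat b) * e"
    by (intro add_mono x y)
  also have "\<dots> \<le> real N * e + real N * e"
    using ab \<open>e \<ge> 0\<close> by (intro add_mono mult_right_mono) auto
  finally show ?thesis using ab by (simp add: e_def algebra_simps)
qed

lemma normalise_grid_fun:
  fixes u :: grid_fun
  defines "u' \<equiv> \<lambda>i j. u i j - u 0 0"
  shows "gradprod h u' u' = gradprod h u u" "laplace_h h u' = laplace_h h u"
    "u \<in> Cper N \<Longrightarrow> u' \<in> Cper N" "u' 0 0 = 0"
  by (simp_all add: u'_def gradprod_def laplace_h_def div_h_def grad_h_def Dx_def Dy_def Cper_def)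

lemma quadratic_nonneg_imp_linear_0:
  fixes a b :: real
  assumes "\<And>t. 0 \<le> a * t + b * t\<^sup>2"
  shows "a = 0"
proof -
  have "((\<lambda>t. a * t + b * t\<^sup>2) has_real_derivative a) (at 0)"
    by (auto intro!: derivative_eq_intros)
  then show ?thesis
    by (rule DERIV_local_min[of _ _ _ 1]) (use assms in auto)
qed

text \<open>The discrete Poisson problem is solved by minimising the Dirichlet energy.\<close>

lemma laplace_surj_mean_zero:
  assumes f: "f \<in> Cper N" "gsum N f = 0" and "N \<ge> 1" "h > 0"
  obtains u where "u \<in> Cper N" "laplace_h h u = f"
proof -
  define I where "I = (\<lambda>u. gsum N (gradprod h u u) / 2 + gsum N (\<lambda>i j. f i j * u i j))"
  define A where "A = {u \<in> Cper N. u 0 0 = 0}"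
  define P where "P = 2 * real N * h * sqrt 2"
  define F where "F = gsum N (\<lambda>i j. \<bar>f i j\<bar>)"
  have "P > 0" using assms by (simp add: P_def)
  have "F \<ge> 0" by (simp add: F_def gsum_nonneg)
  have "closed A"
    unfolding A_def Collect_conj_eq Collect_mem_eq
    by (intro closed_Int closed_Cper closed_Collect_eq continuous_on_grid_eval continuous_on_const)
  have "continuous_on A I"
    unfolding I_def by (intro continuous_intros grid_continuous_intros continuous_on_grid_eval) auto
  \<comment> \<open>I u \<le> I 0 = 0 makes half the Dirichlet energy q^2 at most the linear term,
    itself at most F * P * q by the Poincare bound; dividing by q bounds q.\<close>
  have coercive: "\<bar>u i j\<bar> \<le> P * (2 * (F * P))" if u: "u \<in> A" "I u \<le> 0" for u i j
  proof -
    define q where "q = sqrt (gsum N (gradprod h u u))"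
    have "q \<ge> 0" and q2: "q\<^sup>2 = gsum N (gradprod h u u)"
      unfolding q_def by (simp_all add: gsum_nonneg gradprod_self_nonneg)
    have bound: "\<bar>u i j\<bar> \<le> P * q" for i j
      using grid_bound[of u N h i j] u assms by (simp add: A_def P_def q_def real_sqrt_mult mult.assoc)
    have "- gsum N (\<lambda>i j. f i j * u i j) \<le> gsum N (\<lambda>i j. \<bar>f i j * u i j\<bar>)"
      using gsum_abs[of N "\<lambda>i j. f i j * u i j"] by linarith
    also have "\<dots> \<le> gsum N (\<lambda>i j. (P * q) * \<bar>f i j\<bar>)"
      using bound by (intro gsum_mono) (subst abs_mult, subst mult.commute, intro mult_right_mono abs_ge_zero)
    also have "\<dots> = P * q * F"
      unfolding gsum_linear F_def ..
    finally have "q * q \<le> 2 * (F * P) * q"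
      using u(2) q2 unfolding I_def by (simp add: power2_eq_square algebra_simps)
    then have "q \<le> 2 * (F * P)"
      using \<open>q \<ge> 0\<close> \<open>P > 0\<close> \<open>F \<ge> 0\<close> by (cases "q = 0") (auto simp: mult_le_cancel_right)
    then show ?thesis
      using bound[of i j] mult_left_mono[of q "2 * (F * P)" P] \<open>P > 0\<close> by linarith
  qed
  have I0: "I (\<lambda>i j. 0) = 0" "(\<lambda>i j. 0) \<in> A"
    by (simp_all add: I_def A_def gradprod_def Dx_def Dy_def gsum_const Cper_def)
  obtain u where u: "u \<in> A" and min: "\<And>v. v \<in> A \<Longrightarrow> I u \<le> I v"
    using attains_min_coercive[OF \<open>closed A\<close> \<open>continuous_on A I\<close> I0(2)
        compact_bounded_grid_funs[of "P * (2 * (F * P))"]] coercive I0(1) by auto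
  have uC: "u \<in> Cper N" using u by (simp add: A_def)
  \<comment> \<open>The mean-zero hypothesis enters here: it makes \<open>I\<close> blind to
    constants, so the normalisation at the origin can be lifted.\<close>
  have min': "I u \<le> I v" if v: "v \<in> Cper N" for v
  proof -
    have "I (\<lambda>i j. v i j - v 0 0) = I v"
      using gsum_linear(4)[of N "v 0 0" f] f(2)
      by (simp add: I_def normalise_grid_fun right_diff_distrib gsum_linear mult.commute)
    then show ?thesis
      using min[of "\<lambda>i j. v i j - v 0 0"] normalise_grid_fun(3)[of v N] v by (simp add: A_def)
  qed
  define r where "r = (\<lambda>i j. f i j - laplace_h h u i j)"
  have rC: "r \<in> Cper N"
    unfolding r_def using Cper_period[OF f(1)] Cper_period[OF laplace_Cper[OF uC]]
    by (intro CperI) simp_all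
  \<comment> \<open>Perturbing along the residual itself makes the first variation equal to the
    squared norm of the residual.\<close>
  have "gsum N (\<lambda>i j. r i j * r i j) = 0"
  proof (rule quadratic_nonneg_imp_linear_0)
    fix t :: real
    let ?v = "\<lambda>i j. u i j + t * r i j"
    have "?v \<in> Cper N"
      by (rule CperI; simp add: Cper_period uC rC)
    from min'[OF this] have "0 \<le> I ?v - I u" by simp
    also have "\<dots> = gsum N (\<lambda>i j. r i j * r i j) * t + gsum N (gradprod h r r) / 2 * t\<^sup>2"
    proof -
      have "gradprod h ?v ?v = (\<lambda>i j. gradprod h u u i j + (2 * t) * gradprod h u r i j
          + t\<^sup>2 * gradprod h r r i j)"
        by (intro ext) (simp add: gradprod_linear gradprod_linear_right gradprod_sym[of h r u]
            power2_eq_square algebra_simps)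
      moreover have "(\<lambda>i j. f i j * ?v i j) = (\<lambda>i j. f i j * u i j + t * (f i j * r i j))"
        by (simp add: algebra_simps)
      moreover have "(\<lambda>i j. r i j * r i j) = (\<lambda>i j. f i j * r i j - laplace_h h u i j * r i j)"
        by (simp add: r_def algebra_simps)
      ultimately show ?thesis
        using gsum_laplace[OF uC rC, of h] unfolding I_def
        by (simp only: gsum_linear) (simp add: algebra_simps)
    qed
    finally show "0 \<le> gsum N (\<lambda>i j. r i j * r i j) * t + gsum N (gradprod h r r) / 2 * t\<^sup>2" .
  qed
  then have "r i j * r i j = 0" for i j
    by (rule gsum_eq_0D) (use rC \<open>N \<ge> 1\<close> in \<open>auto intro!: CperI simp: Cper_period\<close>)
  then have "laplace_h h u = f"
    by (intro ext) (simp add: r_def)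
  with uC show thesis by (rule that)
qed

section \<open>The logarithmic entropy\<close>

text \<open>At 0 and 1 the zero factors make the value 0, which is the continuous extension.\<close>

definition entropy :: "real \<Rightarrow> real" where
  "entropy x = x * ln x + (1 - x) * ln (1 - x)"

lemma mult_ln_tangent:
  fixes x m :: real
  assumes "0 \<le> x" "0 < m"
  shows "m * ln m + (ln m + 1) * (x - m) \<le> x * ln x"
proof (cases "x = 0")
  case False
  then have "x * ln (m / x) \<le> x * (m / x - 1)"
    using assms by (intro mult_left_mono ln_le_minus_one) auto
  also have "\<dots> = m - x" using False by (simp add: field_simps)
  finally show ?thesis
    using False assms by (simp add: ln_div algebra_simps)
qed (use assms in \<open>simp add: algebra_simps\<close>)

text \<open>The slope is taken at the interior point m, so x may be an endpoint, where the slope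
  would be infinite.\<close>

lemma entropy_tangent:
  assumes "0 \<le> x" "x \<le> 1" "0 < m" "m < 1"
  shows "entropy m - entropy x \<le> logit m * (m - x)"
  using mult_ln_tangent[of x m] mult_ln_tangent[of "1 - x" "1 - m"] assms
  by (simp add: entropy_def logit_def algebra_simps)

lemma entropy_ge: "0 \<le> x \<Longrightarrow> x \<le> 1 \<Longrightarrow> - 2 \<le> entropy x"
  using mult_ln_tangent[of x 1] mult_ln_tangent[of "1 - x" 1] by (simp add: entropy_def)

lemma continuous_on_entropy: "continuous_on {0..1} entropy"
proof -
  have *: "continuous_on {0..} (\<lambda>x :: real. x * ln x)"
    unfolding continuous_on_eq_continuous_within
  proof
    fix x :: real assume "x \<in> {0..}"
    show "continuous (at x within {0..}) (\<lambda>x. x * ln x)"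
    proof (cases "x = 0")
      case True
      have "((\<lambda>x :: real. x * ln x) \<longlongrightarrow> 0) (at_right 0)" by real_asymp
      then show ?thesis using True
        by (simp add: continuous_within at_within_Ici_at_right)
    next
      case False
      with \<open>x \<in> {0..}\<close> have "x > 0" by simp
      then show ?thesis by (intro continuous_intros) auto
    qed
  qed
  show ?thesis
    unfolding entropy_def
    by (intro continuous_on_add continuous_on_compose2[OF *, of _ "\<lambda>x. 1 - x"]
        continuous_on_subset[OF *] continuous_intros) auto
qed

lemma DERIV_entropy:
  assumes "0 < x" "x < 1"
  shows "(entropy has_real_derivative logit x) (at x)"
  unfolding entropy_def logit_def
  by (rule derivative_eq_intros refl | use assms in simp)+

lemma logit_at_bot:
  assumes "c > 0"
  shows "filterlim (\<lambda>t. logit (t * c)) at_bot (at_right 0)"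
  unfolding logit_def using assms by real_asymp

text \<open>With y = x - 1/2 and threshold m = 1 + F / a: beyond m, y^3 exceeds F / a in absolute
  value and the quartic wins; below m the linear term is at most F * m. The extra F / 2 pays for the
  shift by 1/2.\<close>

lemma quartic_linear_bounded_below:
  fixes a F :: real
  assumes "a > 0" "F \<ge> 0" "\<bar>p\<bar> \<le> F"
  shows "- (F * (1 + F / a)) - F / 2 \<le> a * (x - 1 / 2) ^ 4 + p * x"
proof -
  define y where "y = x - 1 / 2"
  define m where "m = 1 + F / a"
  have m: "m \<ge> 1" using assms by (simp add: m_def)
  have "F * \<bar>y\<bar> - F * m \<le> a * y ^ 4"
  proof (cases "\<bar>y\<bar> \<le> m")
    case True
    then have "F * \<bar>y\<bar> - F * m \<le> 0" using assms by (simp add: mult_left_mono)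
    also have "0 \<le> a * y ^ 4" using assms by simp
    finally show ?thesis .
  next
    case False
    have "F / a * \<bar>y\<bar> \<le> \<bar>y\<bar> ^ 3 * \<bar>y\<bar>"
    proof (rule mult_right_mono)
      have "F / a \<le> \<bar>y\<bar>" using False by (simp add: m_def)
      also have "\<dots> \<le> \<bar>y\<bar> ^ 3"
        using power_increasing[of 1 3 "\<bar>y\<bar>"] False m by simp
      finally show "F / a \<le> \<bar>y\<bar> ^ 3" .
    qed simp
    also have "\<bar>y\<bar> ^ 3 * \<bar>y\<bar> = y ^ 4"
      by (simp add: power_even_abs numeral_eq_Suc mult_ac)
    finally have "F * \<bar>y\<bar> \<le> a * y ^ 4"
      using assms by (simp add: field_simps)
    moreover have "0 \<le> F * m" using assms m by simp
    ultimately show ?thesis by linarith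
  qed
  moreover have "- (F * \<bar>y\<bar>) \<le> p * y"
    using assms mult_right_mono[of "\<bar>p\<bar>" F "\<bar>y\<bar>"] abs_le_iff[of "p * y"] by (simp add: abs_mult)
  moreover have "- (F / 2) \<le> p / 2" using assms by simp
  moreover have "p * x = p * y + p / 2" by (simp add: y_def right_diff_distrib)
  ultimately have "- (F * m) - F / 2 \<le> a * y ^ 4 + p * x" by linarith
  then show ?thesis unfolding y_def m_def .
qed

section \<open>The energy and its minimiser\<close>

lemma gsum_DERIV:
  assumes "\<And>i j. ((\<lambda>t. f t i j) has_real_derivative f' i j) (at x)"
  shows "((\<lambda>t. gsum N (f t)) has_real_derivative gsum N f') (at x)"
  unfolding gsum_def by (intro DERIV_sum assms)

lemma DERIV_gradprod_line:
  "((\<lambda>t. gradprod h (\<lambda>i j. u i j + t * v i j) (\<lambda>i j. u i j + t * v i j) i j)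
     has_real_derivative 2 * gradprod h u v i j) (at 0)"
  unfolding gradprod_linear gradprod_linear_right gradprod_sym[of h v u]
  by (rule derivative_eq_intros refl | simp)+

lemma DERIV_avg_grad_norm_line:
  assumes "\<delta> > 0"
  shows "((\<lambda>t. avg_grad_norm h \<delta> (\<lambda>i j. u i j + t * v i j) i j)
     has_real_derivative gradprod h u v i j / avg_grad_norm h \<delta> u i j) (at 0)"
proof -
  let ?g = "\<lambda>t. gradprod h (\<lambda>i j. u i j + t * v i j) (\<lambda>i j. u i j + t * v i j) i j + \<delta>\<^sup>2"
  have "0 < gradprod h u u i j + \<delta>\<^sup>2"
    using assms gradprod_self_nonneg[of h u i j] by (intro add_nonneg_pos) auto
  then have "(sqrt has_real_derivative inverse (sqrt (gradprod h u u i j + \<delta>\<^sup>2)) / 2) (at (?g 0))"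
    using DERIV_real_sqrt by simp
  moreover have "(?g has_real_derivative 2 * gradprod h u v i j + 0) (at 0)"
    by (intro DERIV_add DERIV_gradprod_line DERIV_const)
  ultimately have "((\<lambda>t. sqrt (?g t)) has_real_derivative
      inverse (sqrt (gradprod h u u i j + \<delta>\<^sup>2)) / 2 * (2 * gradprod h u v i j + 0)) (at 0)"
    by (rule DERIV_chain2[where f = sqrt and g = "?g"])
  moreover have "inverse r / 2 * (2 * x + 0) = x / r" for r x :: real
    by (simp add: field_simps)
  ultimately show ?thesis
    unfolding avg_grad_norm_gradprod by (simp only:)
qed

context phase_scheme
begin

text \<open>An antiderivative of both weak forms except for the logit term. The entropy is kept
  apart since it is not differentiable at 0 and 1.\<close>

definition "smooth_density \<phi> \<rho> = (\<lambda>i j.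
     1 / (4 * \<epsilon>) * (\<phi> i j - 1 / 2) ^ 4 + (\<epsilon> + \<alpha> + \<alpha> / \<delta>) / 2 * grp \<phi> \<phi> i j
     + \<eta>\<^sup>2 / 2 * (lap \<phi> i j)\<^sup>2 + phi_data i j * \<phi> i j
     + \<xi> / 2 * grp \<rho> \<rho> i j + sqrt 2 * \<alpha> / 2 * (\<rho> i j)\<^sup>2
     - \<alpha> * \<rho> i j * agn \<phi> i j - \<alpha> * (sqrt 2 - 1) * \<rho>n i j * \<rho> i j)"

lemma DERIV_smooth_density_phi:
  "((\<lambda>t. smooth_density (\<lambda>i j. \<phi> i j + t * v i j) \<rho> i j) has_real_derivative
     1 / \<epsilon> * (\<phi> i j - 1 / 2) ^ 3 * v i j + (\<epsilon> + \<alpha> + \<alpha> / \<delta>) * grp \<phi> v i j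
     + \<eta>\<^sup>2 * (lap \<phi> i j * lap v i j) - \<alpha> * (\<rho> i j / agn \<phi> i j * grp \<phi> v i j)
     + phi_data i j * v i j) (at 0)"
  unfolding smooth_density_def laplace_linear
  by (rule derivative_eq_intros DERIV_gradprod_line DERIV_avg_grad_norm_line[OF pos(6)] refl)+
    (use pos in \<open>simp add: field_simps\<close>)

lemma DERIV_smooth_density_rho:
  "((\<lambda>t. smooth_density \<phi> (\<lambda>i j. \<rho> i j + t * v i j) i j) has_real_derivative
     \<xi> * grp \<rho> v i j + sqrt 2 * \<alpha> * \<rho> i j * v i j
     - \<alpha> * agn \<phi> i j * v i j - \<alpha> * (sqrt 2 - 1) * \<rho>n i j * v i j) (at 0)"
  unfolding smooth_density_def
  by (rule derivative_eq_intros DERIV_gradprod_line refl)+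
    (simp add: algebra_simps)

text \<open>
  Because \<open>\<phi>\<close> and \<open>\<rho>\<close> are parametrised by potentials \<open>\<psi>\<close> and \<open>\<psi>'\<close>, Dirichlet energies replace the
  discrete \<open>H\<^sup>-\<^sup>1\<close> norms of the increments and mass conservation is automatic.
\<close>

definition "advance \<nu> \<psi> = (\<lambda>i j. \<nu> i j + \<kappa> * lap \<psi> i j)"

definition "smooth_energy \<psi> \<psi>' = \<kappa> / 2 * gsum N (grp \<psi> \<psi>) + \<kappa> / 2 * gsum N (grp \<psi>' \<psi>')
     + gsum N (smooth_density (advance \<phi>n \<psi>) (advance \<rho>n \<psi>'))"

definition "energy \<psi> \<psi>' = smooth_energy \<psi> \<psi>' + \<beta> * gsum N (\<lambda>i j. entropy (advance \<rho>n \<psi>' i j))"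

definition "admissible = {(\<psi>, \<psi>'). \<psi> \<in> Cper N \<and> \<psi>' \<in> Cper N
     \<and> (\<forall>i j. 0 \<le> advance \<rho>n \<psi>' i j \<and> advance \<rho>n \<psi>' i j \<le> 1)}"

lemma advance_Cper: "\<nu> \<in> Cper N \<Longrightarrow> \<psi> \<in> Cper N \<Longrightarrow> advance \<nu> \<psi> \<in> Cper N"
  unfolding advance_def using Cper_period[OF laplace_Cper] by (intro CperI) (simp_all add: Cper_period)

lemma advance_line:
  "advance \<nu> (\<lambda>i j. \<psi> i j + t * v i j) = (\<lambda>i j. advance \<nu> \<psi> i j + t * (\<kappa> * lap v i j))"
  by (simp add: advance_def laplace_linear algebra_simps)

lemma phi_data_Cper: "phi_data \<in> Cper N"
  unfolding phi_data_def
  by (rule CperI; simp add: Cper_period data_Cper laplace_Cper)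

text \<open>The quartic controls the linear term in \<phi>, and G \<le> (G^2 + 1) / 2 lets the
  gradient energy control the coupling. The sums F and F' merely stand in for sup norms of the
  data.\<close>

lemma smooth_density_bounded_below:
  obtains C where "\<And>\<phi> \<rho> i j. 0 \<le> \<rho> i j \<Longrightarrow> \<rho> i j \<le> 1 \<Longrightarrow> - C \<le> smooth_density \<phi> \<rho> i j"
proof
  define F where "F = gsum N (\<lambda>i j. \<bar>phi_data i j\<bar>)"
  define F' where "F' = gsum N (\<lambda>i j. \<bar>\<rho>n i j\<bar>)"
  fix \<phi> \<rho> :: grid_fun and i j
  assume \<rho>: "0 \<le> \<rho> i j" "\<rho> i j \<le> 1"
  have data: "\<bar>phi_data i j\<bar> \<le> F" "\<bar>\<rho>n i j\<bar> \<le> F'"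
    unfolding F_def F'_def using pos(9)
    by (intro gsum_ge_member[of "\<lambda>i j. \<bar>phi_data i j\<bar>"] gsum_ge_member[of "\<lambda>i j. \<bar>\<rho>n i j\<bar>"] CperI;
        simp add: Cper_period phi_data_Cper data_Cper)+
  then have "F \<ge> 0" by linarith
  have "- (F * (1 + F / (1 / (4 * \<epsilon>)))) - F / 2 \<le> 1 / (4 * \<epsilon>) * (\<phi> i j - 1 / 2) ^ 4 + phi_data i j * \<phi> i j"
    by (rule quartic_linear_bounded_below) (use pos data \<open>F \<ge> 0\<close> in auto)
  moreover have "\<alpha> * \<rho> i j * agn \<phi> i j \<le> \<alpha> / 2 * grp \<phi> \<phi> i j + \<alpha> / 2 * (\<delta>\<^sup>2 + 1)"
  proof -
    have G: "0 \<le> agn \<phi> i j" using avg_grad_norm_ge[OF pos(6), of h \<phi> i j] pos by simp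
    have "\<rho> i j * agn \<phi> i j \<le> 1 * agn \<phi> i j"
      using \<rho> G by (intro mult_right_mono)
    also have "\<dots> \<le> ((agn \<phi> i j)\<^sup>2 + 1) / 2"
      using zero_le_power2[of "agn \<phi> i j - 1"] by (simp add: power2_eq_square algebra_simps)
    finally have "\<alpha> * (\<rho> i j * agn \<phi> i j) \<le> \<alpha> * ((grp \<phi> \<phi> i j + \<delta>\<^sup>2 + 1) / 2)"
      using pos by (simp add: avg_grad_norm_square)
    then show ?thesis by (simp add: algebra_simps)
  qed
  moreover have "\<alpha> / 2 * grp \<phi> \<phi> i j \<le> (\<epsilon> + \<alpha> + \<alpha> / \<delta>) / 2 * grp \<phi> \<phi> i j"
    using pos by (intro mult_right_mono) (auto simp: gradprod_self_nonneg)
  moreover have "0 \<le> \<eta>\<^sup>2 / 2 * (lap \<phi> i j)\<^sup>2" "0 \<le> \<xi> / 2 * grp \<rho> \<rho> i j"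
    "0 \<le> sqrt 2 * \<alpha> / 2 * (\<rho> i j)\<^sup>2"
    using pos by (auto simp: gradprod_self_nonneg)
  moreover have "\<alpha> * (sqrt 2 - 1) * \<rho>n i j * \<rho> i j \<le> \<alpha> * (sqrt 2 - 1) * F'"
  proof -
    have "\<rho>n i j * \<rho> i j \<le> \<bar>\<rho>n i j\<bar> * 1"
      using \<rho> by (intro mult_mono) auto
    then have "\<rho>n i j * \<rho> i j \<le> F'" using data by simp
    then show ?thesis
      using pos unfolding mult.assoc by (intro mult_left_mono) auto
  qed
  ultimately show "- (F * (1 + F / (1 / (4 * \<epsilon>))) + F / 2 + \<alpha> / 2 * (\<delta>\<^sup>2 + 1) + \<alpha> * (sqrt 2 - 1) * F')
      \<le> smooth_density \<phi> \<rho> i j"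
    unfolding smooth_density_def by linarith
qed

lemma energy_coercive:
  obtains C where "\<And>\<psi> \<psi>'. (\<psi>, \<psi>') \<in> admissible \<Longrightarrow>
     \<kappa> / 2 * gsum N (grp \<psi> \<psi>) + \<kappa> / 2 * gsum N (grp \<psi>' \<psi>') - C \<le> energy \<psi> \<psi>'"
proof -
  obtain c where c: "\<And>\<phi> \<rho> i j. 0 \<le> \<rho> i j \<Longrightarrow> \<rho> i j \<le> 1 \<Longrightarrow> - c \<le> smooth_density \<phi> \<rho> i j"
    using smooth_density_bounded_below by blast
  show thesis
  proof
    fix \<psi> \<psi>' assume "(\<psi>, \<psi>') \<in> admissible"
    then have r: "0 \<le> advance \<rho>n \<psi>' i j" "advance \<rho>n \<psi>' i j \<le> 1" for i j
      by (auto simp: admissible_def)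
    have "gsum N (\<lambda>i j. - c) \<le> gsum N (smooth_density (advance \<phi>n \<psi>) (advance \<rho>n \<psi>'))"
      by (intro gsum_mono c r)
    moreover have "\<beta> * gsum N (\<lambda>i j. - 2) \<le> \<beta> * gsum N (\<lambda>i j. entropy (advance \<rho>n \<psi>' i j))"
      using pos by (intro mult_left_mono gsum_mono entropy_ge r) auto
    ultimately show "\<kappa> / 2 * gsum N (grp \<psi> \<psi>) + \<kappa> / 2 * gsum N (grp \<psi>' \<psi>')
        - ((real N)\<^sup>2 * c + \<beta> * ((real N)\<^sup>2 * 2)) \<le> energy \<psi> \<psi>'"
      unfolding energy_def smooth_energy_def gsum_const by simp
  qed
qed

section \<open>Continuity, closedness and existence of a minimiser\<close>

lemma continuous_on_advance:
  assumes "\<And>i j. continuous_on A (\<lambda>s. u s i j)"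
  shows "continuous_on A (\<lambda>s. advance \<nu> (u s) i j)"
  unfolding advance_def by (intro continuous_intros grid_continuous_intros assms)

lemma continuous_on_energy: "continuous_on admissible (\<lambda>(\<psi>, \<psi>'). energy \<psi> \<psi>')"
proof -
  have u: "continuous_on A (\<lambda>s :: grid_fun \<times> grid_fun. fst s i j)"
    "continuous_on A (\<lambda>s :: grid_fun \<times> grid_fun. snd s i j)" for A i j
    by (rule continuous_on_compose2[OF continuous_on_grid_eval[of UNIV]];
        auto intro: continuous_intros)+
  have a: "continuous_on A (\<lambda>s :: grid_fun \<times> grid_fun. advance \<nu> (fst s) i j)"
    "continuous_on A (\<lambda>s :: grid_fun \<times> grid_fun. advance \<nu> (snd s) i j)" for A \<nu> i j
    by (intro continuous_on_advance u)+
  have "continuous_on admissible (\<lambda>s. entropy (advance \<rho>n (snd s) i j))" for i j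
    by (rule continuous_on_compose2[OF continuous_on_entropy a(2)]) (auto simp: admissible_def)
  moreover have "continuous_on A
      (\<lambda>s. smooth_density (advance \<phi>n (fst s)) (advance \<rho>n (snd s)) i j)" for A i j
    unfolding smooth_density_def by (intro continuous_intros grid_continuous_intros a)
  ultimately show ?thesis
    unfolding energy_def smooth_energy_def case_prod_beta
    by (intro continuous_on_add continuous_on_mult continuous_on_const grid_continuous_intros u)
qed

lemma closed_admissible: "closed admissible"
proof -
  have u: "continuous_on A (\<lambda>s :: grid_fun \<times> grid_fun. snd s i j)" for A i j
    by (rule continuous_on_compose2[OF continuous_on_grid_eval[of UNIV]])
      (auto intro: continuous_intros)
  have "admissible = Cper N \<times> Cper N \<inter> {s. \<forall>i j. 0 \<le> advance \<rho>n (snd s) i j \<and> advance \<rho>n (snd s) i j \<le> 1}"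
    by (auto simp: admissible_def)
  moreover have "closed {s :: grid_fun \<times> grid_fun. \<forall>i j. 0 \<le> advance \<rho>n (snd s) i j \<and> advance \<rho>n (snd s) i j \<le> 1}"
    by (intro closed_Collect_all closed_Collect_conj closed_Collect_le continuous_on_advance u
        continuous_on_const)
  ultimately show ?thesis
    by (simp add: closed_Int closed_Times closed_Cper)
qed

text \<open>Coercivity controls only Dirichlet energies, leaving additive constants in the
  potentials free. Energy and admissibility ignore these constants, so one may minimise over
  potentials vanishing at the origin, where \<open>grid_bound\<close> gives compactness.\<close>

lemma energy_min_exists:
  assumes adm: "(\<psi>0, \<psi>0') \<in> admissible"
  obtains \<psi> \<psi>' where "(\<psi>, \<psi>') \<in> admissible"
    "\<And>\<theta> \<theta>'. (\<theta>, \<theta>') \<in> admissible \<Longrightarrow> energy \<psi> \<psi>' \<le> energy \<theta> \<theta>'"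
proof -
  define nm :: "grid_fun \<Rightarrow> grid_fun" where "nm = (\<lambda>u i j. u i j - u 0 0)"
  have nm: "gradprod h (nm u) (nm u) = gradprod h u u" "laplace_h h (nm u) = laplace_h h u"
    "u \<in> Cper N \<Longrightarrow> nm u \<in> Cper N" "nm u 0 0 = 0" for u
    unfolding nm_def by (rule normalise_grid_fun; assumption?)+
  have nm_energy: "energy (nm \<theta>) (nm \<theta>') = energy \<theta> \<theta>'" for \<theta> \<theta>'
    by (simp add: energy_def smooth_energy_def advance_def nm)
  have nm_adm: "(nm \<theta>, nm \<theta>') \<in> admissible" if "(\<theta>, \<theta>') \<in> admissible" for \<theta> \<theta>'
    using that by (auto simp: admissible_def advance_def nm)
  define Z :: "grid_fun set" where "Z = {u. u 0 0 = 0}"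
  define A where "A = admissible \<inter> Z \<times> Z"
  obtain C where C: "\<And>\<psi> \<psi>'. (\<psi>, \<psi>') \<in> admissible \<Longrightarrow>
     \<kappa> / 2 * gsum N (grp \<psi> \<psi>) + \<kappa> / 2 * gsum N (grp \<psi>' \<psi>') - C \<le> energy \<psi> \<psi>'"
    using energy_coercive by blast
  \<comment> \<open>q bounds the Dirichlet energies on the sublevel set of the starting pair, and R
    is the resulting sup bound.\<close>
  define q where "q = 2 / \<kappa> * (energy \<psi>0 \<psi>0' + C)"
  define R where "R = 2 * real N * h * sqrt (2 * q)"
  define K :: "grid_fun set" where "K = {u. \<forall>i j. \<bar>u i j\<bar> \<le> R}"
  have bound: "u \<in> K" if "u \<in> Cper N" "u 0 0 = 0" "gsum N (grp u u) \<le> q" for u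
  proof -
    have "\<bar>u i j\<bar> \<le> R" for i j
    proof -
      have "\<bar>u i j\<bar> \<le> 2 * real N * h * sqrt (2 * gsum N (grp u u))"
        using grid_bound that pos by blast
      also have "\<dots> \<le> R"
        unfolding R_def using that(3) pos by (intro mult_left_mono) auto
      finally show ?thesis .
    qed
    then show ?thesis by (simp add: K_def)
  qed
  have "closed Z"
    unfolding Z_def by (intro closed_Collect_eq continuous_on_grid_eval continuous_on_const)
  then have "closed A"
    unfolding A_def by (intro closed_Int closed_admissible closed_Times)
  moreover have "continuous_on A (\<lambda>(\<psi>, \<psi>'). energy \<psi> \<psi>')"
    using continuous_on_energy by (rule continuous_on_subset) (simp add: A_def)
  moreover have "(nm \<psi>0, nm \<psi>0') \<in> A"
    using nm_adm[OF adm] by (simp add: A_def Z_def nm)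
  moreover have "compact (K \<times> K)"
    unfolding K_def by (intro compact_Times compact_bounded_grid_funs)
  moreover have "s \<in> K \<times> K"
    if s: "s \<in> A" and le: "(\<lambda>(\<psi>, \<psi>'). energy \<psi> \<psi>') s \<le> (\<lambda>(\<psi>, \<psi>'). energy \<psi> \<psi>') (nm \<psi>0, nm \<psi>0')"
    for s
  proof -
    obtain \<theta> \<theta>' where s': "s = (\<theta>, \<theta>')" by force
    have "(\<theta>, \<theta>') \<in> admissible" and z: "\<theta> 0 0 = 0" "\<theta>' 0 0 = 0"
      using s by (auto simp: s' A_def Z_def)
    then have "\<kappa> / 2 * (gsum N (grp \<theta> \<theta>) + gsum N (grp \<theta>' \<theta>')) \<le> energy \<psi>0 \<psi>0' + C"
      and per: "\<theta> \<in> Cper N" "\<theta>' \<in> Cper N"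
      using C[of \<theta> \<theta>'] le by (auto simp: s' nm_energy admissible_def distrib_left)
    then have "gsum N (grp \<theta> \<theta>) + gsum N (grp \<theta>' \<theta>') \<le> q"
      using pos by (simp add: q_def field_simps)
    moreover have "0 \<le> gsum N (grp \<theta> \<theta>)" "0 \<le> gsum N (grp \<theta>' \<theta>')"
      by (simp_all add: gsum_nonneg gradprod_self_nonneg)
    ultimately show ?thesis
      using bound per z by (simp add: s')
  qed
  ultimately have "\<exists>s\<in>A. \<forall>t\<in>A. (\<lambda>(\<psi>, \<psi>'). energy \<psi> \<psi>') s \<le> (\<lambda>(\<psi>, \<psi>'). energy \<psi> \<psi>') t"
    by (rule attains_min_coercive)
  then obtain s where s: "s \<in> A" "\<forall>t\<in>A. (\<lambda>(\<psi>, \<psi>'). energy \<psi> \<psi>') s \<le> (\<lambda>(\<psi>, \<psi>'). energy \<psi> \<psi>') t"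
    by (rule bexE)
  obtain \<psi> \<psi>' where s_eq: "s = (\<psi>, \<psi>')" by (rule prod.exhaust)
  have m: "energy \<psi> \<psi>' \<le> energy \<theta> \<theta>'" if "(\<theta>, \<theta>') \<in> A" for \<theta> \<theta>'
    using bspec[OF s(2) that] by (simp add: s_eq)
  have "energy \<psi> \<psi>' \<le> energy \<theta> \<theta>'" if "(\<theta>, \<theta>') \<in> admissible" for \<theta> \<theta>'
    using m[of "nm \<theta>" "nm \<theta>'"] nm_adm[OF that] by (simp add: A_def Z_def nm nm_energy)
  with s(1) show thesis by (intro that) (auto simp: A_def s_eq)
qed

text \<open>
  Moving from a minimiser towards a constant density with the right mass costs at most a finite
  slope in every smooth term, whereas the entropy has slope \<open>- \<infinity>\<close> wherever the minimiser touches
  0 or 1.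
\<close>

lemma energy_min_interior:
  assumes adm: "(\<psi>, \<psi>') \<in> admissible"
    and min: "\<And>\<theta> \<theta>'. (\<theta>, \<theta>') \<in> admissible \<Longrightarrow> energy \<psi> \<psi>' \<le> energy \<theta> \<theta>'"
    and const: "\<psi>m \<in> Cper N" "advance \<rho>n \<psi>m = (\<lambda>i j. m)" "0 < m" "m < 1"
  shows "0 < advance \<rho>n \<psi>' i j \<and> advance \<rho>n \<psi>' i j < 1"
proof (rule ccontr)
  assume touch: "\<not> ?thesis"
  define \<rho> where "\<rho> = advance \<rho>n \<psi>'"
  \<comment> \<open>Along this direction the density is the convex combination of \<rho> and m, so
    it becomes strictly interior for 0 < t < 1.\<close>
  define v where "v = (\<lambda>i j. \<psi>m i j - \<psi>' i j)"
  define Q where "Q = (\<lambda>t. smooth_energy \<psi> (\<lambda>i j. \<psi>' i j + t * v i j))"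
  have per: "\<psi> \<in> Cper N" "\<psi>' \<in> Cper N" and \<rho>01: "0 \<le> \<rho> i j" "\<rho> i j \<le> 1" for i j
    using adm by (auto simp: admissible_def \<rho>_def)
  have \<rho>C: "\<rho> \<in> Cper N" unfolding \<rho>_def by (intro advance_Cper data_Cper per)
  have "\<kappa> * lap v i j = m - \<rho> i j" for i j
  proof -
    have "\<kappa> * lap v i j = advance \<rho>n \<psi>m i j - advance \<rho>n \<psi>' i j"
      by (simp add: v_def advance_def laplace_linear algebra_simps)
    then show ?thesis by (simp add: const(2) \<rho>_def)
  qed
  then have line: "advance \<rho>n (\<lambda>i j. \<psi>' i j + t * v i j) = (\<lambda>i j. \<rho> i j + t * (m - \<rho> i j))" for t
    by (simp add: advance_line \<rho>_def)
  have "\<exists>b. (Q has_real_derivative b) (at 0)"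
    unfolding Q_def smooth_energy_def line
    by (rule exI) (rule derivative_eq_intros gsum_DERIV DERIV_gradprod_line DERIV_smooth_density_rho refl)+
  then obtain b where "(Q has_real_derivative b) (at 0)" ..
  then have "((\<lambda>t. (Q t - Q 0) / t) \<longlongrightarrow> b) (at_right 0)"
    unfolding has_field_derivative_iff by (auto intro: tendsto_mono[OF at_le])
  then have ev1: "\<forall>\<^sub>F t in at_right 0. (Q t - Q 0) / t < b + 1"
    by (rule order_tendstoD) simp
  have ev2: "\<forall>\<^sub>F t :: real in at_right 0. 0 < t \<and> t < 1"
    unfolding eventually_at_right_field by (intro exI[of _ 1]) auto
  \<comment> \<open>In the touching cell, t * c is the distance of the perturbed density from the
    endpoint it leaves.\<close>
  define c where "c = (if \<rho> i j = 0 then m else 1 - m)"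
  have c: "c > 0" using const by (simp add: c_def)
  \<comment> \<open>The first part covers the entropy slopes of all cells, the second the slope of
    the smooth terms; beating B at the touching cell yields the contradiction.\<close>
  define B where "B = (real N)\<^sup>2 * \<bar>logit m\<bar> + (b + 1) / \<beta>"
  have ev3: "\<forall>\<^sub>F t in at_right 0. logit (t * c) < - B / c"
    using logit_at_bot[OF c] by (simp add: filterlim_at_bot_dense)
  obtain t where t: "(Q t - Q 0) / t < b + 1" "0 < t" "t < 1" "logit (t * c) < - B / c"
    using eventually_happens'[OF _ eventually_conj[OF ev1 eventually_conj[OF ev2 ev3]]] by auto
  define \<rho>t where "\<rho>t = (\<lambda>i j. \<rho> i j + t * (m - \<rho> i j))"
  have \<rho>t_conv: "\<rho>t i j = (1 - t) * \<rho> i j + t * m" for i j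
    by (simp add: \<rho>t_def algebra_simps)
  have \<rho>t01: "0 < \<rho>t i j" "\<rho>t i j < 1" for i j
  proof -
    show "0 < \<rho>t i j" unfolding \<rho>t_conv
      using \<rho>01[of i j] t const by (intro add_nonneg_pos) auto
    have "(1 - t) * \<rho> i j + t * m < (1 - t) * 1 + t * 1"
      using \<rho>01[of i j] t const by (intro add_le_less_mono mult_left_mono mult_strict_left_mono) auto
    then show "\<rho>t i j < 1" unfolding \<rho>t_conv by simp
  qed
  have "energy \<psi> \<psi>' \<le> energy \<psi> (\<lambda>i j. \<psi>' i j + t * v i j)"
  proof (rule min)
    have "(\<lambda>i j. \<psi>' i j + t * v i j) \<in> Cper N"
      unfolding v_def by (rule CperI; simp add: Cper_period per const)
    then show "(\<psi>, \<lambda>i j. \<psi>' i j + t * v i j) \<in> admissible"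
      using \<rho>t01 per by (auto simp: admissible_def line \<rho>t_def less_imp_le)
  qed
  then have "0 \<le> (Q t - Q 0) + \<beta> * gsum N (\<lambda>i j. entropy (\<rho>t i j) - entropy (\<rho> i j))"
    unfolding energy_def line gsum_linear Q_def by (simp add: \<rho>_def \<rho>t_def algebra_simps)
  also have "\<dots> \<le> (Q t - Q 0) + \<beta> * gsum N (\<lambda>i j. t * (logit (\<rho>t i j) * (m - \<rho> i j)))"
  proof -
    have "entropy (\<rho>t i j) - entropy (\<rho> i j) \<le> t * (logit (\<rho>t i j) * (m - \<rho> i j))" for i j
      using entropy_tangent[OF \<rho>01 \<rho>t01, of i j i j] by (simp add: \<rho>t_def mult_ac)
    then show ?thesis
      using pos by (intro add_left_mono mult_left_mono gsum_mono) auto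
  qed
  also have "\<dots> = t * ((Q t - Q 0) / t + \<beta> * gsum N (\<lambda>i j. logit (\<rho>t i j) * (m - \<rho> i j)))"
    using t unfolding gsum_linear by (simp add: field_simps)
  finally have "0 \<le> (Q t - Q 0) / t + \<beta> * gsum N (\<lambda>i j. logit (\<rho>t i j) * (m - \<rho> i j))"
    using t by (simp add: zero_le_mult_iff)
  then have lower: "0 < (b + 1) + \<beta> * gsum N (\<lambda>i j. logit (\<rho>t i j) * (m - \<rho> i j))"
    using t by linarith
  \<comment> \<open>Adding \<open>\<bar>logit m\<bar>\<close> makes every cell's contribution
    nonnegative, so the touching cell alone bounds the sum from below.\<close>
  define w where "w = (\<lambda>i j. \<bar>logit m\<bar> - logit (\<rho>t i j) * (m - \<rho> i j))"
  have "w i j \<ge> 0" for i j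
  proof -
    have "logit (\<rho>t i j) * (m - \<rho> i j) \<le> logit m * (m - \<rho> i j)"
    proof (cases "\<rho> i j \<le> m")
      case True
      have "\<rho>t i j \<le> m"
        unfolding \<rho>t_conv using True t mult_left_mono[of "\<rho> i j" m "1 - t"] by (simp add: algebra_simps)
      then show ?thesis
        using True \<rho>t01 const by (intro mult_right_mono logit_mono) auto
    next
      case False
      have "m \<le> \<rho>t i j"
        unfolding \<rho>t_conv using False t mult_left_mono[of m "\<rho> i j" "1 - t"] by (simp add: algebra_simps)
      then show ?thesis
        using False \<rho>t01 const by (intro mult_right_mono_neg logit_mono) auto
    qed
    also have "\<dots> \<le> \<bar>logit m\<bar> * \<bar>m - \<rho> i j\<bar>"
      by (metis abs_ge_self abs_mult)
    also have "\<dots> \<le> \<bar>logit m\<bar> * 1"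
      using \<rho>01[of i j] const by (intro mult_left_mono) auto
    finally show ?thesis by (simp add: w_def)
  qed
  then have "w i j \<le> gsum N w"
    by (rule gsum_ge_member) (use pos \<rho>C in \<open>auto intro!: CperI simp: w_def \<rho>t_def Cper_period\<close>)
  also have "\<dots> = (real N)\<^sup>2 * \<bar>logit m\<bar> - gsum N (\<lambda>i j. logit (\<rho>t i j) * (m - \<rho> i j))"
    unfolding w_def gsum_linear gsum_const ..
  finally have "gsum N (\<lambda>i j. logit (\<rho>t i j) * (m - \<rho> i j)) \<le> (real N)\<^sup>2 * \<bar>logit m\<bar> - w i j"
    by simp
  moreover have "w i j \<ge> - (logit (t * c) * c)"
  proof -
    have "\<rho> i j = 0 \<or> \<rho> i j = 1"
      using touch \<rho>01[of i j] by (auto simp: \<rho>_def)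
    \<comment> \<open>Oddness about 1/2 reduces contact with 1 to contact with 0.\<close>
    moreover have "logit (1 - x) = - logit x" for x by (simp add: logit_def)
    from this[of "t * (1 - m)"] have "logit (1 + t * (m - 1)) = - logit (t * (1 - m))"
      by (simp add: algebra_simps)
    ultimately show ?thesis
      by (auto simp: w_def \<rho>t_def c_def algebra_simps)
  qed
  moreover have "logit (t * c) * c < - B"
    using t(4) c by (simp only: pos_less_divide_eq)
  ultimately have "gsum N (\<lambda>i j. logit (\<rho>t i j) * (m - \<rho> i j)) < - ((b + 1) / \<beta>)"
    unfolding B_def by linarith
  then have "\<beta> * gsum N (\<lambda>i j. logit (\<rho>t i j) * (m - \<rho> i j)) < - (b + 1)"
    using pos by (simp add: field_simps)
  with lower show False by linarith
qed

text \<open>The weak identity says that \<mu> - \<psi> is orthogonal to all Laplacians; testing with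
  v = lap (\<mu> - \<psi>) gives the squared norm of v. Constants stay invisible, hence a conclusion
  about Laplacians, which is all that the scheme sees.\<close>

lemma laplace_eq_of_weak:
  assumes "\<mu> \<in> Cper N" "\<psi> \<in> Cper N"
    and weak: "\<And>v. v \<in> Cper N \<Longrightarrow>
      \<kappa> * gsum N (grp \<psi> v) + gsum N (\<lambda>i j. \<mu> i j * (\<kappa> * lap v i j)) = 0"
  shows "lap \<mu> = lap \<psi>"
proof -
  define r where "r = (\<lambda>i j. \<mu> i j - \<psi> i j)"
  define v where "v = lap r"
  have rC: "r \<in> Cper N" unfolding r_def by (rule CperI; simp add: Cper_period assms)
  then have vC: "v \<in> Cper N" unfolding v_def by (rule laplace_Cper)
  have "\<kappa> * gsum N (\<lambda>i j. v i j * v i j) = \<kappa> * gsum N (\<lambda>i j. r i j * lap v i j)"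
    using gsum_laplace_sym[OF rC vC, of h] by (simp add: v_def)
  also have "\<dots> = gsum N (\<lambda>i j. \<mu> i j * (\<kappa> * lap v i j)) - \<kappa> * gsum N (\<lambda>i j. \<psi> i j * lap v i j)"
    unfolding r_def by (simp only: gsum_linear[symmetric]) (simp add: algebra_simps)
  also have "\<dots> = 0"
  proof -
    have "gsum N (grp \<psi> v) = - gsum N (\<lambda>i j. \<psi> i j * lap v i j)"
      using gsum_laplace_sym[OF assms(2) vC, of h] gsum_laplace[OF assms(2) vC, of h] by simp
    with weak[OF vC] show ?thesis by simp
  qed
  finally have "gsum N (\<lambda>i j. v i j * v i j) = 0" using pos by simp
  then have "v i j * v i j = 0" for i j
    by (rule gsum_eq_0D) (use vC pos in \<open>auto intro!: CperI simp: Cper_period\<close>)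
  then show ?thesis by (auto simp: v_def r_def laplace_linear fun_eq_iff)
qed

lemma energy_min_solves:
  assumes adm: "(\<psi>, \<psi>') \<in> admissible"
    and min: "\<And>\<theta> \<theta>'. (\<theta>, \<theta>') \<in> admissible \<Longrightarrow> energy \<psi> \<psi>' \<le> energy \<theta> \<theta>'"
    and inside: "\<And>i j. 0 < advance \<rho>n \<psi>' i j \<and> advance \<rho>n \<psi>' i j < 1"
  shows "solves (advance \<phi>n \<psi>) (advance \<rho>n \<psi>')"
proof -
  define \<phi> where "\<phi> = advance \<phi>n \<psi>"
  define \<rho> where "\<rho> = advance \<rho>n \<psi>'"
  have per: "\<psi> \<in> Cper N" "\<psi>' \<in> Cper N"
    using adm by (auto simp: admissible_def)
  have C: "\<phi> \<in> Cper N" "\<rho> \<in> Cper N"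
    unfolding \<phi>_def \<rho>_def by (intro advance_Cper data_Cper per)+
  have line_C: "(\<lambda>i j. u i j + t * v i j) \<in> Cper N" if "u \<in> Cper N" "v \<in> Cper N" for u v and t :: real
    by (rule CperI; simp add: Cper_period that)
  have "lap (mu1 \<phi> \<rho>) = lap \<psi>"
  proof (rule laplace_eq_of_weak)
    fix v assume v: "v \<in> Cper N"
    define z where "z = (\<lambda>i j. \<kappa> * lap v i j)"
    have line: "advance \<nu> (\<lambda>i j. \<psi> i j + t * v i j) = (\<lambda>i j. advance \<nu> \<psi> i j + t * z i j)" for \<nu> \<psi> t
      by (simp add: advance_line z_def)
    have zC: "z \<in> Cper N" unfolding z_def by (rule CperI; simp add: Cper_period laplace_Cper v)
    have "((\<lambda>t. energy (\<lambda>i j. \<psi> i j + t * v i j) \<psi>') has_real_derivative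
       \<kappa> * gsum N (grp \<psi> v) + gsum N (\<lambda>i j. mu1 \<phi> \<rho> i j * z i j)) (at 0)"
      unfolding energy_def smooth_energy_def line mu1_weak[OF C zC] \<phi>_def[symmetric] \<rho>_def[symmetric]
      by (rule derivative_eq_intros gsum_DERIV DERIV_gradprod_line DERIV_smooth_density_phi refl)+
        (simp add: gsum_linear)
    then have "\<kappa> * gsum N (grp \<psi> v) + gsum N (\<lambda>i j. mu1 \<phi> \<rho> i j * z i j) = 0"
    proof (rule DERIV_local_min[of _ _ _ 1])
      have "energy \<psi> \<psi>' \<le> energy (\<lambda>i j. \<psi> i j + t * v i j) \<psi>'" for t
        by (rule min) (use adm line_C v in \<open>auto simp: admissible_def\<close>)
      then show "\<forall>y. \<bar>0 - y\<bar> < 1 \<longrightarrow> energy (\<lambda>i j. \<psi> i j + 0 * v i j) \<psi>' \<le> energy (\<lambda>i j. \<psi> i j + y * v i j) \<psi>'"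
        by simp
    qed simp
    then show "\<kappa> * gsum N (grp \<psi> v) + gsum N (\<lambda>i j. mu1 \<phi> \<rho> i j * (\<kappa> * lap v i j)) = 0"
      by (simp add: z_def)
  qed (intro mu1_Cper C per)+
  moreover have "lap (mu2 \<phi> \<rho>) = lap \<psi>'"
  proof (rule laplace_eq_of_weak)
    fix v assume v: "v \<in> Cper N"
    define z where "z = (\<lambda>i j. \<kappa> * lap v i j)"
    have line: "advance \<nu> (\<lambda>i j. \<psi> i j + t * v i j) = (\<lambda>i j. advance \<nu> \<psi> i j + t * z i j)" for \<nu> \<psi> t
      by (simp add: advance_line z_def)
    have zC: "z \<in> Cper N" unfolding z_def by (rule CperI; simp add: Cper_period laplace_Cper v)
    have ent: "((\<lambda>t. entropy (\<rho> i j + t * z i j)) has_real_derivative logit (\<rho> i j) * z i j) (at 0)" for i j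
    proof -
      have "(entropy has_real_derivative logit (\<rho> i j)) (at (\<rho> i j + 0 * z i j))"
        using DERIV_entropy inside by (simp add: \<rho>_def)
      moreover have "((\<lambda>t. \<rho> i j + t * z i j) has_real_derivative z i j) (at 0)"
        by (auto intro!: derivative_eq_intros)
      ultimately show ?thesis by (rule DERIV_chain2)
    qed
    have deriv: "((\<lambda>t. energy \<psi> (\<lambda>i j. \<psi>' i j + t * v i j)) has_real_derivative
       \<kappa> * gsum N (grp \<psi>' v) + gsum N (\<lambda>i j. mu2 \<phi> \<rho> i j * z i j)) (at 0)"
      unfolding energy_def smooth_energy_def line mu2_weak[OF C zC] \<phi>_def[symmetric] \<rho>_def[symmetric]
      by (rule derivative_eq_intros gsum_DERIV DERIV_gradprod_line DERIV_smooth_density_rho ent refl)+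
        (simp add: gsum_linear mult.assoc)
    \<comment> \<open>Strict bounds on the finitely many cells of one period give a common radius,
      and periodicity extends it to all cells. The \<phi> direction is unconstrained, so any radius
      worked there.\<close>
    obtain d where d: "d > 0" "\<And>t. \<bar>t\<bar> < d \<Longrightarrow> (\<psi>, \<lambda>i j. \<psi>' i j + t * v i j) \<in> admissible"
    proof -
      have lim: "((\<lambda>t. \<rho> i j + t * z i j) \<longlongrightarrow> \<rho> i j + 0 * z i j) (nhds 0)" for i j
        by (intro tendsto_intros filterlim_ident)
      have "\<forall>\<^sub>F t in nhds 0. 0 < \<rho> i j + t * z i j \<and> \<rho> i j + t * z i j < 1" for i j
        using order_tendstoD(1)[OF lim, of 0 i j] order_tendstoD(2)[OF lim, of i j 1] inside[of i j]
        by (simp add: \<rho>_def eventually_conj)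
      then have "\<forall>\<^sub>F t in nhds 0. \<forall>(i, j)\<in>{1..int N} \<times> {1..int N}.
          0 < \<rho> i j + t * z i j \<and> \<rho> i j + t * z i j < 1"
        by (intro eventually_ball_finite) auto
      then obtain d where d: "d > 0" "\<And>t a b. \<bar>t\<bar> < d \<Longrightarrow> a \<in> {1..int N} \<Longrightarrow> b \<in> {1..int N} \<Longrightarrow>
          0 < \<rho> a b + t * z a b \<and> \<rho> a b + t * z a b < 1"
        unfolding eventually_nhds_metric by (auto simp: dist_real_def)
      have "0 \<le> \<rho> i j + t * z i j \<and> \<rho> i j + t * z i j \<le> 1" if "\<bar>t\<bar> < d" for t i j
      proof -
        obtain a b where ab: "a \<in> {1..int N}" "b \<in> {1..int N}"
          and rep: "\<And>v. v \<in> Cper N \<Longrightarrow> v a b = v i j"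
          using Cper_rep[OF pos(9)] by metis
        show ?thesis
          using d(2)[OF that ab] unfolding rep[OF C(2)] rep[OF zC] by simp
      qed
      then have "(\<psi>, \<lambda>i j. \<psi>' i j + t * v i j) \<in> admissible" if "\<bar>t\<bar> < d" for t
        using that per v line_C by (simp add: admissible_def line \<rho>_def)
      with d(1) show thesis by (rule that)
    qed
    have "\<kappa> * gsum N (grp \<psi>' v) + gsum N (\<lambda>i j. mu2 \<phi> \<rho> i j * z i j) = 0"
      by (rule DERIV_local_min[OF deriv d(1)]) (use d(2) min in auto)
    then show "\<kappa> * gsum N (grp \<psi>' v) + gsum N (\<lambda>i j. mu2 \<phi> \<rho> i j * (\<kappa> * lap v i j)) = 0"
      by (simp add: z_def)
  qed (intro mu2_Cper C per)+
  \<comment> \<open>Replacing \<open>lap \<psi>\<close> and \<open>lap \<psi>'\<close> in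
    \<open>advance\<close> by the Laplacians of the potentials \<open>mu1\<close> and
    \<open>mu2\<close> turns its definition into the scheme.\<close>
  ultimately show ?thesis
    using inside C unfolding solves_def by (simp add: \<phi>_def[symmetric] \<rho>_def[symmetric])
      (simp add: \<phi>_def \<rho>_def advance_def)
qed

text \<open>Equal mass makes m - \<rho>n mean-zero, so the Poisson problem applies. The constant
  state is both the feasible starting point and the interior target.\<close>

lemma constant_density:
  assumes "gsum N \<rho>n = (real N)\<^sup>2 * m"
  obtains \<psi>m where "\<psi>m \<in> Cper N" "advance \<rho>n \<psi>m = (\<lambda>i j. m)"
proof -
  define f where "f = (\<lambda>i j. 1 / \<kappa> * (m - \<rho>n i j))"
  have "f \<in> Cper N"
    unfolding f_def by (rule CperI; simp add: Cper_period data_Cper)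
  moreover have "gsum N f = 0"
    unfolding f_def gsum_linear gsum_const using assms by simp
  ultimately obtain u where "u \<in> Cper N" "laplace_h h u = f"
    using laplace_surj_mean_zero pos by blast
  then show thesis
    using pos by (intro that[of u]) (auto simp: advance_def f_def)
qed

lemma solves_exists:
  assumes mean: "gsum N \<rho>n = (real N)\<^sup>2 * m" "0 < m" "m < 1"
  shows "\<exists>\<phi> \<rho>. solves \<phi> \<rho>"
proof -
  obtain \<psi>m where m: "\<psi>m \<in> Cper N" "advance \<rho>n \<psi>m = (\<lambda>i j. m)"
    using constant_density mean by blast
  have "((\<lambda>i j. 0), \<psi>m) \<in> admissible"
    using m mean by (simp add: admissible_def Cper_def)
  then obtain \<psi> \<psi>' where min: "(\<psi>, \<psi>') \<in> admissible"
    "\<And>\<theta> \<theta>'. (\<theta>, \<theta>') \<in> admissible \<Longrightarrow> energy \<psi> \<psi>' \<le> energy \<theta> \<theta>'"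
    using energy_min_exists by blast
  show ?thesis
    using energy_min_solves[OF min energy_min_interior[OF min m mean(2,3)]] by blast
qed

end

theorem theorem3p1:
  fixes \<alpha> \<beta> \<epsilon> \<eta> \<xi> \<delta> Mob \<Delta>t L h M :: real
    and N :: nat
    and \<phi>n \<rho>n :: grid_fun
  assumes "\<alpha> > 0" "\<beta> > 0" "\<epsilon> > 0" "\<eta> > 0" "\<xi> > 0" "\<delta> > 0" "Mob > 0" "\<Delta>t > 0"
    and "L > 0" "N \<ge> 1" "h = L / real N"
    and "\<phi>n \<in> Cper N" "\<rho>n \<in> Cper N"
    and "M \<ge> 0" "grid_norm_inf N \<rho>n \<le> M"
    and "0 < grid_mean L N \<rho>n" "grid_mean L N \<rho>n < 1"
  shows "\<exists>!s. case s of (\<phi>, \<rho>) \<Rightarrow>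
           \<phi> \<in> Cper N \<and> \<rho> \<in> Cper N
           \<and> (\<forall>i j. 0 < \<rho> i j \<and> \<rho> i j < 1)
           \<and> (\<forall>i j. (\<phi> i j - \<phi>n i j) / \<Delta>t = Mob * laplace_h h (mu_phi h \<alpha> \<epsilon> \<eta> \<delta> \<phi>n \<phi> \<rho>) i j)
           \<and> (\<forall>i j. (\<rho> i j - \<rho>n i j) / \<Delta>t = Mob * laplace_h h (mu_rho h \<alpha> \<beta> \<xi> \<delta> \<rho>n \<phi> \<rho>) i j)"
proof -
  interpret phase_scheme \<alpha> \<beta> \<epsilon> \<eta> \<xi> \<delta> "Mob * \<Delta>t" h N \<phi>n \<rho>n
    using assms by unfold_locales simp_all
  define m where "m = grid_mean L N \<rho>n"
  have "gsum N \<rho>n = (real N)\<^sup>2 * m"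
    using assms(9,10) by (simp add: m_def grid_mean_def gsum_def power_divide)
  then obtain \<phi> \<rho> where sol: "solves \<phi> \<rho>"
    using solves_exists[of m] assms(16,17) unfolding m_def by blast
  have scaled: "x / \<Delta>t = Mob * y \<longleftrightarrow> x = Mob * \<Delta>t * y" for x y
    using assms(8) by (auto simp: field_simps)
  show ?thesis
    unfolding scaled
  proof (rule ex1I[of _ "(\<phi>, \<rho>)"], goal_cases)
    case 1
    show ?case using sol by (simp add: solves_def)
  next
    case (2 s)
    obtain \<phi>' \<rho>' where s: "s = (\<phi>', \<rho>')" by (rule prod.exhaust)
    from 2 have "solves \<phi>' \<rho>'" by (simp add: s solves_def)
    from solves_unique[OF this sol] show ?case by (simp add: s)
  qed
qed

end
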